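(* Let $x_1,\dots,x_n$ be complex parameters such that no denominator below vanishes. Then $$\begin{aligned} \pi_{q} &=(1-q^{2})\sum_{k_1,\dots,k_n\ge0}\ \prod_{1\leq r<s\leq n}\frac{1-q^{2k_{r}-2k_{s}}x_{r}/x_{s}}{1-x_{r}/x_{s}}\prod_{r=1}^{n}x_{r}^{nk_{r}-|\boldsymbol{k}|}\\ &\quad\times\frac{(1-q^{4|\boldsymbol{k}|+2})(q^{2};q^{2})_{|\boldsymbol{k}|}}{\prod_{r,s=1}^{n}(q^{2}x_{r}/x_{s};q^{2})_{k_{r}}}\cdot(-1)^{n|\boldsymbol{k}|}q^{2\sum_{r=1}^{n}(r-1)k_{r}+2n\sum_{r=1}^{n}\binom{k_{r}}{2}+\frac{1}{4}}\\ &\quad\times\sum_{\substack{0\leq m_{r}\leq k_{r}\\ r=1,\dots,n}}\ \prod_{1\leq r<s\leq n}\frac{1-q^{2m_{r}-2m_{s}}x_{r}/x_{s}}{1-x_{r}/x_{s}}\prod_{r,s=1}^{n}\frac{(q^{-2k_{s}}x_{r}/x_{s};q^{2})_{m_{r}}}{(q^{2}x_{r}/x_{s};q^{2})_{m_{r}}}\cdot\frac{(q^{2|\boldsymbol{k}|+2},q^{2};q^{2})_{|\boldsymbol{m}|}}{(q,q;q^{2})_{|\boldsymbol{m}|}}q^{2\sum_{r=1}^{n}rm_{r}} \end{aligned}$$ and $$\begin{aligned} \pi_{q} &=(1-q^{2})q^{1/4}+(1-q^{2})\sum_{\substack{k_{1},\dots,k_n\geq0\\ |\boldsymbol{k}|\geq1}}\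 \prod_{1\leq r<s\leq n}\frac{1-q^{2k_{r}-2k_{s}}x_{r}/x_{s}}{1-x_{r}/x_{s}}\cdot\frac{(1-q^{4|\boldsymbol{k}|})(q^{2};q^{2})_{|\boldsymbol{k}|-1}}{\prod_{r,s=1}^{n}(q^{2}x_{r}/x_{s};q^{2})_{k_{r}}}\\ &\quad\times(-1)^{n|\boldsymbol{k}|}q^{2\sum_{r=1}^{n}(r-1)k_{r}+2n\sum_{r=1}^{n}\binom{k_{r}}{2}+\frac{1}{4}}\prod_{r=1}^{n}x_{r}^{nk_{r}-|\boldsymbol{k}|}\\ &\quad\times\sum_{\substack{0\leq m_{r}\leq k_{r}\\ r=1,\dots,n}}\ \prod_{1\leq r<s\leq n}\frac{1-q^{2m_{r}-2m_{s}}x_{r}/x_{s}}{1-x_{r}/x_{s}}\prod_{r,s=1}^{n}\frac{(q^{-2k_{s}}x_{r}/x_{s};q^{2})_{m_{r}}}{(q^{2}x_{r}/x_{s};q^{2})_{m_{r}}}\cdot\frac{(q^{2|\boldsymbol{k}|},q^{2};q^{2})_{|\boldsymbol{m}|}}{(q,q;q^{2})_{|\boldsymbol{m}|}}q^{2\sum_{r=1}^{n}rm_{r}}. \end{aligned}$$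
   Context: $q$ is a complex number with $0<|q|<1$, with a fixed choice of the fourth root $q^{1/4}$ (used consistently), and $n\ge1$ is an integer. $(z;q^2)_\infty=\prod_{i\ge0}(1-zq^{2i})$, $(z;q^2)_k=\prod_{i=0}^{k-1}(1-zq^{2i})$, and $(c_1,\dots,c_p;q^2)_k=(c_1;q^2)_k\cdots(c_p;q^2)_k$. The $q$-analogue of $\pi$ is $$\pi_{q}:=(1-q^{2})q^{1/4}\frac{(q^{2};q^{2})_{\infty}^{2}}{(q;q^{2})_{\infty}^{2}}.$$ Bold letters denote multi-indices of nonnegative integers, $\boldsymbol k=(k_1,\dots,k_n)$, with $|\boldsymbol k|=k_1+\cdots+k_n$. *)

theory Defs
  imports "HOL-Analysis.Analysis"
begin

definition qpoch :: "complex \<Rightarrow> complex \<Rightarrow> nat \<Rightarrow> complex" where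
  "qpoch z p k = (\<Prod>i<k. 1 - z * p ^ i)"

text \<open>For \<open>norm p < 1\<close> the product converges, so \<^const>\<open>prodinf\<close> is its genuine value
  (also when a factor vanishes).\<close>
definition qpoch_inf :: "complex \<Rightarrow> complex \<Rightarrow> complex" where
  "qpoch_inf z p = prodinf (\<lambda>i. 1 - z * p ^ i)"

text \<open>In this and the later definitions, \<open>w\<close> is the chosen fourth root of \<open>q\<close>,
  i.e. \<open>w ^ 4 = q\<close>.\<close>
definition pi_q :: "complex \<Rightarrow> complex \<Rightarrow> complex" where
  "pi_q w q = (1 - q\<^sup>2) * w * (qpoch_inf (q\<^sup>2) (q\<^sup>2))\<^sup>2 / (qpoch_inf q (q\<^sup>2))\<^sup>2"

text \<open>Multi-indices \<open>(k\<^sub>1, \<dots>, k\<^sub>n)\<close> are extensional functions on \<open>{1..n}\<close>, so that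
  each multi-index is represented exactly once.\<close>
definition multi_indices :: "nat \<Rightarrow> (nat \<Rightarrow> nat) set" where
  "multi_indices n = {1..n} \<rightarrow>\<^sub>E UNIV"

definition multi_indices_le :: "nat \<Rightarrow> (nat \<Rightarrow> nat) \<Rightarrow> (nat \<Rightarrow> nat) set" where
  "multi_indices_le n k = (\<Pi>\<^sub>E r\<in>{1..n}. {0..k r})"

definition msize :: "nat \<Rightarrow> (nat \<Rightarrow> nat) \<Rightarrow> nat" where
  "msize n k = (\<Sum>r=1..n. k r)"

definition vandermonde_ratio ::
    "complex \<Rightarrow> nat \<Rightarrow> (nat \<Rightarrow> complex) \<Rightarrow> (nat \<Rightarrow> nat) \<Rightarrow> complex" where
  "vandermonde_ratio q n x k =
     (\<Prod>r\<in>{1..n}. \<Prod>s\<in>{r<..n}.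
        (1 - q powi (2 * int (k r) - 2 * int (k s)) * (x r / x s)) / (1 - x r / x s))"

definition denom_prod ::
    "complex \<Rightarrow> nat \<Rightarrow> (nat \<Rightarrow> complex) \<Rightarrow> (nat \<Rightarrow> nat) \<Rightarrow> complex" where
  "denom_prod q n x k = (\<Prod>r=1..n. \<Prod>s=1..n. qpoch (q\<^sup>2 * (x r / x s)) (q\<^sup>2) (k r))"

text \<open>The inner sum over \<open>m\<close>. The two series differ only in the parameter \<open>a\<close>, which is
  \<open>q ^ (2 * msize n k + 2)\<close> in the first and \<open>q ^ (2 * msize n k)\<close> in the second.\<close>
definition inner_sum ::
    "complex \<Rightarrow> nat \<Rightarrow> (nat \<Rightarrow> complex) \<Rightarrow> complex \<Rightarrow> (nat \<Rightarrow> nat) \<Rightarrow> complex" where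
  "inner_sum q n x a k =
     (\<Sum>m\<in>multi_indices_le n k.
        vandermonde_ratio q n x m
        * (\<Prod>r=1..n. \<Prod>s=1..n.
             qpoch (q powi (- 2 * int (k s)) * (x r / x s)) (q\<^sup>2) (m r)
             / qpoch (q\<^sup>2 * (x r / x s)) (q\<^sup>2) (m r))
        * (qpoch a (q\<^sup>2) (msize n m) * qpoch (q\<^sup>2) (q\<^sup>2) (msize n m)
           / (qpoch q (q\<^sup>2) (msize n m) * qpoch q (q\<^sup>2) (msize n m)))
        * q ^ (2 * (\<Sum>r=1..n. r * m r)))"

text \<open>The common factor
  \<open>(-1)\<^bsup>n|k|\<^esup> q\<^bsup>2 \<Sum>(r-1)k\<^sub>r + 2n \<Sum>binom(k\<^sub>r,2) + 1/4\<^esup> \<Prod>x\<^sub>r\<^bsup>n k\<^sub>r - |k|\<^esup>\<close>.\<close>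
definition monomial_factor ::
    "complex \<Rightarrow> complex \<Rightarrow> nat \<Rightarrow> (nat \<Rightarrow> complex) \<Rightarrow> (nat \<Rightarrow> nat) \<Rightarrow> complex" where
  "monomial_factor w q n x k =
     (-1) ^ (n * msize n k)
     * (q ^ (2 * (\<Sum>r=1..n. (r - 1) * k r) + 2 * n * (\<Sum>r=1..n. k r choose 2)) * w)
     * (\<Prod>r=1..n. x r powi (int (n * k r) - int (msize n k)))"

definition summand1 ::
    "complex \<Rightarrow> complex \<Rightarrow> nat \<Rightarrow> (nat \<Rightarrow> complex) \<Rightarrow> (nat \<Rightarrow> nat) \<Rightarrow> complex" where
  "summand1 w q n x k =
     vandermonde_ratio q n x k
     * ((1 - q ^ (4 * msize n k + 2)) * qpoch (q\<^sup>2) (q\<^sup>2) (msize n k) / denom_prod q n x k)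
     * monomial_factor w q n x k
     * inner_sum q n x (q ^ (2 * msize n k + 2)) k"

text \<open>Only used for \<open>msize n k \<ge> 1\<close>, where the subtraction is not truncated.\<close>
definition summand2 ::
    "complex \<Rightarrow> complex \<Rightarrow> nat \<Rightarrow> (nat \<Rightarrow> complex) \<Rightarrow> (nat \<Rightarrow> nat) \<Rightarrow> complex" where
  "summand2 w q n x k =
     vandermonde_ratio q n x k
     * ((1 - q ^ (4 * msize n k)) * qpoch (q\<^sup>2) (q\<^sup>2) (msize n k - 1) / denom_prod q n x k)
     * monomial_factor w q n x k
     * inner_sum q n x (q ^ (2 * msize n k)) k"

end

theory Submission
  imports Defs
begin

text \<open>Put \<open>p = q\<^sup>2\<close>. By Milne's fundamental theorem for basic hypergeometric series of type \<open>A\<^sub>n\<close>, summing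
  over all multi-indices of a given size collapses to a one-dimensional factor. Applied to the inner
  sum, this shows that the latter depends on \<open>k\<close> only through \<open>K = |k|\<close> and equals a
  terminating \<open>\<^sub>3\<phi>\<^sub>2\<close>; applied once more to the outer sum, it reduces both identities to the case
  \<open>n = 1\<close>. There the \<open>K\<close>-th term is the inverse Bailey transform, relative to \<open>a = p\<close> in the first
  and \<open>a = 1\<close> in the second identity, of the sequence \<open>\<beta>\<^sub>m = 1 / (q; p)\<^sub>m\<^sup>2\<close>. Letting \<open>N\<close> tend to infinity
  in the Bailey transform \<open>\<beta>\<^sub>N = \<Sum>\<^sub>r \<alpha>\<^sub>r / ((p)\<^bsub>N-r\<^esub> (ap)\<^bsub>N+r\<^esub>)\<close> yields the value. The double series itself
  is not absolutely convergent: the terms with \<open>m\<close> near \<open>k\<close> do not decay, and it is the cancellation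
  in the inner sum, made visible by an Abel summation, that makes the outer series converge
  absolutely.\<close>

section \<open>q-Pochhammer symbols\<close>

lemma qpoch_0 [simp]: "qpoch z p 0 = 1"
  by (simp add: qpoch_def)

lemma qpoch_Suc: "qpoch z p (Suc k) = qpoch z p k * (1 - z * p ^ k)"
  by (simp add: qpoch_def)

lemma qpoch_add: "qpoch z p (m + n) = qpoch z p m * qpoch (z * p ^ m) p n"
  by (induction n) (simp_all add: qpoch_Suc power_add mult.assoc)

lemma Suc_choose_2: "Suc k choose 2 = k + (k choose 2)"
  by (simp add: numeral_2_eq_2)

lemma power_neq_1_of_norm_less_1:
  fixes z :: complex
  assumes "norm z < 1" "k > 0"
  shows "z ^ k \<noteq> 1"
proof
  assume "z ^ k = 1"
  then have "norm z ^ k = 1"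
    by (metis norm_one norm_power)
  moreover have "norm z ^ k < 1"
    using assms by (simp add: power_less_one_iff)
  ultimately show False by simp
qed

lemma norm_mult_power_less_1:
  fixes z p :: complex
  assumes "norm z < 1" "norm p < 1"
  shows "norm (z * p ^ k) < 1"
proof -
  have "norm (z * p ^ k) \<le> norm z * 1"
    unfolding norm_mult norm_power using assms by (intro mult_left_mono power_le_one) auto
  then show ?thesis using assms by simp
qed

lemma qpoch_nonzero:
  assumes "norm z < 1" "norm p < 1"
  shows "qpoch z p k \<noteq> 0"
proof -
  have "1 - z * p ^ i \<noteq> 0" for i
    using norm_mult_power_less_1[OF assms, of i] by auto
  then show ?thesis by (simp add: qpoch_def)
qed

lemma convergent_prod_qpoch:
  fixes z p :: complex
  assumes "norm p < 1"
  shows "convergent_prod (\<lambda>i. 1 - z * p ^ i)"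
proof (rule abs_convergent_prod_imp_convergent_prod, rule summable_imp_abs_convergent_prod)
  have "summable (\<lambda>i. norm z * norm p ^ i)"
    using assms by (intro summable_mult summable_geometric) auto
  then show "summable (\<lambda>i. norm (1 - z * p ^ i - 1))"
    by (simp add: norm_mult norm_power)
qed

lemma qpoch_tendsto:
  assumes "norm p < 1"
  shows "(\<lambda>n. qpoch z p n) \<longlonglongrightarrow> qpoch_inf z p"
proof -
  have "(\<lambda>n. \<Prod>i\<le>n. 1 - z * p ^ i) \<longlonglongrightarrow> qpoch_inf z p"
    unfolding qpoch_inf_def by (rule convergent_prod_LIMSEQ[OF convergent_prod_qpoch[OF assms]])
  then have "(\<lambda>n. qpoch z p (Suc n)) \<longlonglongrightarrow> qpoch_inf z p"
    by (simp add: qpoch_def lessThan_Suc_atMost)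
  then show ?thesis by (rule LIMSEQ_imp_Suc)
qed

lemma qpoch_inf_nonzero:
  assumes "norm p < 1" "\<And>k. qpoch z p k \<noteq> 0"
  shows "qpoch_inf z p \<noteq> 0"
  unfolding qpoch_inf_def
proof (rule prodinf_nonzero[OF convergent_prod_qpoch[OF assms(1)]])
  fix i show "1 - z * p ^ i \<noteq> 0"
    using assms(2)[of "Suc i"] by (simp add: qpoch_Suc)
qed

lemma qpoch_bounded:
  assumes "norm p < 1"
  obtains B where "B > 0" "\<And>k. norm (qpoch z p k) \<le> B"
proof -
  have "Bseq (\<lambda>n. qpoch z p n)"
    by (rule convergent_imp_Bseq) (use qpoch_tendsto[OF assms] in \<open>auto simp: convergent_def\<close>)
  then show thesis using that by (auto elim: BseqE)
qed

lemma inverse_qpoch_bounded: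
  assumes "norm p < 1" "\<And>k. qpoch z p k \<noteq> 0"
  obtains B where "B > 0" "\<And>k. norm (inverse (qpoch z p k)) \<le> B"
proof -
  have "(\<lambda>n. inverse (qpoch z p n)) \<longlonglongrightarrow> inverse (qpoch_inf z p)"
    by (intro tendsto_inverse qpoch_tendsto assms qpoch_inf_nonzero)
  then have "Bseq (\<lambda>n. inverse (qpoch z p n))"
    by (intro convergent_imp_Bseq) (auto simp: convergent_def)
  then show thesis using that by (auto elim: BseqE)
qed

section \<open>The inverse Bailey transform\<close>

text \<open>With \<open>s = 2 * m + e\<close>, \<open>i = K - m\<close> and \<open>a = p ^ e\<close>
  this is the factor \<open>(1 - a p^(2K)) (ap;p)_(K+m-1)\<close> of the inverse Bailey matrix,
  multiplied by \<open>(p;p)_e\<close>. The case \<open>i = 0\<close> is split off because at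
  \<open>s = i = 0\<close> the factor \<open>1 - p ^ 0\<close> meets the index -1; the value
  required there is 1.\<close>

definition bailey_gamma :: "complex \<Rightarrow> nat \<Rightarrow> nat \<Rightarrow> complex" where
  "bailey_gamma p s i =
     (if i = 0 then qpoch p p s else (1 - p ^ (s + 2 * i)) * qpoch p p (s + i - 1))"

text \<open>The inverse Bailey transform relative to \<open>a = p ^ e\<close>, up to the factor \<open>qpoch p p e\<close>.\<close>
definition bailey_alpha :: "complex \<Rightarrow> (nat \<Rightarrow> complex) \<Rightarrow> nat \<Rightarrow> nat \<Rightarrow> complex" where
  "bailey_alpha p \<beta> e K =
     (\<Sum>m\<le>K. \<beta> m * ((-1) ^ (K - m) * p ^ ((K - m) choose 2) / qpoch p p (K - m)
                    * bailey_gamma p (2 * m + e) (K - m)))"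

text \<open>The sum that expresses orthogonality is indefinitely summable: every proper partial sum
  is a product. Hence induction on \<open>I\<close> works and comes down to one rational identity in
  \<open>p ^ I\<close>, \<open>p ^ D\<close> and \<open>p ^ s\<close>.\<close>

lemma bailey_partial_sum:
  assumes p: "norm p < 1" and "I < M"
  shows "(\<Sum>i\<le>I. (-1) ^ i * p ^ (i choose 2) * bailey_gamma p s i
             / (qpoch p p i * qpoch p p (M - i) * qpoch p p (s + M + i)))
         = (-1) ^ I * p ^ (Suc I choose 2) * qpoch p p (s + I)
             / (qpoch p p I * qpoch p p (M - I - 1) * qpoch p p (s + M + I) * (1 - p ^ M))"
  using \<open>I < M\<close>
proof (induction I)
  case 0
  then obtain M' where "M = Suc M'" by (cases M) auto
  then show ?case by (simp add: bailey_gamma_def qpoch_Suc binomial_eq_0)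
next
  case (Suc I)
  obtain D where D: "M = I + 2 + D" using Suc.prems by (metis add_2_eq_Suc' less_eq_Suc_le le_Suc_ex)
  have nz1: "1 - p ^ Suc k \<noteq> 0" for k using power_neq_1_of_norm_less_1[OF p, of "Suc k"] by simp
  \<comment> \<open>All three quantities of the induction step are \<open>c\<close> times a rational
    function of \<open>P\<close>, \<open>Q\<close>, \<open>S\<close> and \<open>p\<close>.\<close>
  define P where "P = p ^ I" define Q where "Q = p ^ D" define S where "S = p ^ s"
  define c where "c = (-1) ^ I * p ^ (Suc I choose 2) * qpoch p p (s + I)
        / (qpoch p p I * qpoch p p D * qpoch p p (s + M + I))"
  have M: "p ^ M = p^2 * P * Q" by (simp add: D P_def Q_def power_add power2_eq_square)
  have M0: "1 - p ^ M \<noteq> 0" using power_neq_1_of_norm_less_1[OF p, of M] D by simp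
  have a1: "1 - p * P \<noteq> 0" using nz1[of I] by (simp add: P_def)
  have a2: "1 - p * Q \<noteq> 0" using nz1[of D] by (simp add: Q_def)
  have a3: "1 - p * (S * (p^2 * P * Q) * P) \<noteq> 0"
    using nz1[of "s + M + I"] by (simp add: S_def P_def M power_add)
  have ch: "Suc (Suc I) choose 2 = Suc I + (Suc I choose 2)" by (rule Suc_choose_2)
  have t: "(-1) ^ Suc I * p ^ (Suc I choose 2) * bailey_gamma p s (Suc I)
        / (qpoch p p (Suc I) * qpoch p p (M - Suc I) * qpoch p p (s + M + Suc I))
      = - c * (1 - S * p^2 * P^2) / ((1 - p * P) * (1 - p * Q) * (1 - p * (S * (p^2 * P * Q) * P)))"
  proof -
    have e: "M - Suc I = Suc D" "s + M + Suc I = Suc (s + M + I)" using D by auto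
    have "bailey_gamma p s (Suc I) = (1 - S * p^2 * P^2) * qpoch p p (s + I)"
      by (simp add: bailey_gamma_def S_def P_def power_add power2_eq_square mult_2)
    moreover have "p ^ (s + M + I) = S * (p^2 * P * Q) * P"
      by (simp add: power_add M S_def P_def)
    moreover have "p ^ D = Q" "p ^ I = P" by (simp_all add: Q_def P_def)
    ultimately show ?thesis
      unfolding e c_def qpoch_Suc by (simp add: mult_ac)
  qed
  have lhs: "(-1) ^ I * p ^ (Suc I choose 2) * qpoch p p (s + I)
             / (qpoch p p I * qpoch p p (M - I - 1) * qpoch p p (s + M + I) * (1 - p ^ M))
      = c / ((1 - p * Q) * (1 - p^2 * P * Q))"
  proof -
    have e: "M - I - 1 = Suc D" using D by auto
    show ?thesis unfolding e c_def qpoch_Suc M[symmetric] by (simp add: Q_def)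
  qed
  have rhs: "(-1) ^ Suc I * p ^ (Suc (Suc I) choose 2) * qpoch p p (s + Suc I)
             / (qpoch p p (Suc I) * qpoch p p (M - Suc I - 1) * qpoch p p (s + M + Suc I) * (1 - p ^ M))
      = - c * (p * P) * (1 - p * (S * P))
          / ((1 - p * P) * (1 - p * (S * (p^2 * P * Q) * P)) * (1 - p^2 * P * Q))"
  proof -
    have e: "M - Suc I - 1 = D" "s + M + Suc I = Suc (s + M + I)" "s + Suc I = Suc (s + I)"
      using D by auto
    have "p ^ (s + M + I) = S * (p^2 * P * Q) * P" "p ^ (s + I) = S * P"
      by (simp_all add: power_add M S_def P_def)
    moreover have "p ^ I = P" by (simp_all add: P_def)
    ultimately show ?thesis
      unfolding e c_def qpoch_Suc ch M[symmetric] power_add by (simp add: mult_ac S_def)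
  qed
  have b1: "1 - p^2 * P * Q \<noteq> 0" using M0 M by simp
  have key: "c / ((1 - p * Q) * (1 - p^2 * P * Q))
       + - c * (1 - S * p^2 * P^2) / ((1 - p * P) * (1 - p * Q) * (1 - p * (S * (p^2 * P * Q) * P)))
       = - c * (p * P) * (1 - p * (S * P))
          / ((1 - p * P) * (1 - p * (S * (p^2 * P * Q) * P)) * (1 - p^2 * P * Q))"
    (is "?l = ?r")
  proof -
    let ?A = "1 - p * P" and ?B = "1 - p * Q" and ?C = "1 - p * (S * (p^2 * P * Q) * P)"
      and ?D = "1 - p^2 * P * Q"
    have "?l = c * (?A * ?C - (1 - S * p^2 * P^2) * ?D) / (?A * ?B * ?C * ?D)"
      using a1 a2 a3 b1 by (simp add: divide_simps) (simp add: algebra_simps)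
    \<comment> \<open>The numerator contains the factor \<open>?B\<close>, which cancels against the
      denominator; this is what keeps the partial sums in product form.\<close>
    also have "?A * ?C - (1 - S * p^2 * P^2) * ?D = - (p * P) * (1 - p * (S * P)) * ?B"
      by (simp add: algebra_simps power2_eq_square)
    also have "c * (- (p * P) * (1 - p * (S * P)) * ?B) / (?A * ?B * ?C * ?D) = ?r"
      using a1 a2 a3 b1 by (simp add: divide_simps)
    finally show ?thesis .
  qed
  have "I < M" using Suc.prems by simp
  show ?case
    unfolding sum.atMost_Suc Suc.IH[OF \<open>I < M\<close>] lhs rhs t using key by simp
qed

text \<open>For \<open>M > 0\<close> the partial sum up to \<open>M - 1\<close> is exactly the
  negative of the last term. This says that the Bailey matrix and its inverse multiply to the
  identity.\<close>

lemma bailey_orthogonality: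
  assumes p: "norm p < 1"
  shows "(\<Sum>i\<le>M. (-1) ^ i * p ^ (i choose 2) * bailey_gamma p s i
             / (qpoch p p i * qpoch p p (M - i) * qpoch p p (s + M + i)))
         = (if M = 0 then 1 else 0)"
proof (cases M)
  case 0
  then show ?thesis using qpoch_nonzero[OF p p] by (simp add: bailey_gamma_def binomial_eq_0)
next
  case (Suc I)
  have nz1: "1 - p ^ Suc k \<noteq> 0" for k using power_neq_1_of_norm_less_1[OF p, of "Suc k"] by simp
  have ps: "(\<Sum>i\<le>I. (-1) ^ i * p ^ (i choose 2) * bailey_gamma p s i
             / (qpoch p p i * qpoch p p (M - i) * qpoch p p (s + M + i)))
         = (-1) ^ I * p ^ (Suc I choose 2) * qpoch p p (s + I)
             / (qpoch p p I * qpoch p p 0 * qpoch p p (s + M + I) * (1 - p ^ M))"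
    using bailey_partial_sum[OF p, of I M s] Suc by simp
  have e1: "s + M + M = Suc (s + M + I)" using Suc by simp
  have e2: "bailey_gamma p s M = (1 - p ^ Suc (s + M + I)) * qpoch p p (s + I)"
  proof -
    have "s + 2 * M = Suc (s + M + I)" "s + M - 1 = s + I" using Suc by auto
    moreover have "M \<noteq> 0" using Suc by simp
    ultimately show ?thesis unfolding bailey_gamma_def by (simp only: if_False)
  qed
  have q1: "qpoch p p (s + M + M) = qpoch p p (s + M + I) * (1 - p ^ Suc (s + M + I))"
    unfolding e1 qpoch_Suc by simp
  have q2: "qpoch p p M = qpoch p p I * (1 - p ^ M)" unfolding Suc qpoch_Suc by simp
  have "(-1) ^ M * p ^ (M choose 2) * bailey_gamma p s M
             / (qpoch p p M * qpoch p p (M - M) * qpoch p p (s + M + M))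
     = - ((-1) ^ I * p ^ (M choose 2) * qpoch p p (s + I)
             / (qpoch p p I * qpoch p p (s + M + I) * (1 - p ^ M)))"
    unfolding e2 q1 q2 using nz1[of "s + M + I"] by (simp add: Suc mult_ac)
  then show ?thesis using ps by (simp add: Suc)
qed

text \<open>After interchanging the sums, the sum over \<open>K\<close> for fixed \<open>m\<close>
  is the orthogonality sum with \<open>M = N - m\<close> and \<open>s = 2 * m + e\<close>, so only
  \<open>m = N\<close> survives. The factor \<open>(p;p)_e\<close> carried by
  \<open>bailey_alpha\<close> turns \<open>(ap;p)_(N+K)\<close> into
  \<open>(p;p)_(N+K+e)\<close>.\<close>

theorem bailey_inversion:
  assumes p: "norm p < 1"
  shows "(\<Sum>K\<le>N. bailey_alpha p \<beta> e K / (qpoch p p (N - K) * qpoch p p (N + K + e))) = \<beta> N"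
proof -
  define f where "f m K = \<beta> m * ((-1) ^ (K - m) * p ^ ((K - m) choose 2) / qpoch p p (K - m)
                    * bailey_gamma p (2 * m + e) (K - m))
                    / (qpoch p p (N - K) * qpoch p p (N + K + e))" for m K
  have "(\<Sum>K\<le>N. bailey_alpha p \<beta> e K / (qpoch p p (N - K) * qpoch p p (N + K + e)))
      = (\<Sum>K\<le>N. \<Sum>m\<le>K. f m K)"
    by (simp add: bailey_alpha_def f_def sum_divide_distrib)
  also have "\<dots> = (\<Sum>m\<le>N. \<Sum>K\<in>{m..N}. f m K)"
    unfolding sum.Sigma[OF finite_atMost ballI[OF finite_atMost]]
      sum.Sigma[OF finite_atMost ballI[OF finite_atLeastAtMost]]
    by (rule sum.reindex_bij_witness[of _ "\<lambda>(a,b). (b,a)" "\<lambda>(a,b). (b,a)"]) auto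
  also have "\<dots> = (\<Sum>m\<le>N. \<beta> m * (if N - m = 0 then 1 else 0))"
  proof (rule sum.cong[OF refl])
    fix m assume "m \<in> {..N}"
    then obtain M where M: "N = m + M" by (auto dest: le_Suc_ex)
    have "(\<Sum>K\<in>{m..N}. f m K) = (\<Sum>i\<le>M. f m (m + i))"
      by (rule sum.reindex_bij_witness[of _ "\<lambda>i. m + i" "\<lambda>K. K - m"]) (auto simp: M)
    also have "\<dots> = \<beta> m * (\<Sum>i\<le>M. (-1) ^ i * p ^ (i choose 2) * bailey_gamma p (2 * m + e) i
             / (qpoch p p i * qpoch p p (M - i) * qpoch p p (2 * m + e + M + i)))"
      unfolding sum_distrib_left
    proof (rule sum.cong[OF refl])
      fix i assume "i \<in> {..M}"
      have e: "N + (m + i) + e = 2 * m + e + M + i" "N - (m + i) = M - i" "m + i - m = i"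
        using M by auto
      show "f m (m + i) = \<beta> m * ((-1) ^ i * p ^ (i choose 2) * bailey_gamma p (2 * m + e) i
             / (qpoch p p i * qpoch p p (M - i) * qpoch p p (2 * m + e + M + i)))"
        unfolding f_def e by simp
    qed
    also have "\<dots> = \<beta> m * (if N - m = 0 then 1 else 0)"
      unfolding bailey_orthogonality[OF p] using M by simp
    finally show "(\<Sum>K\<in>{m..N}. f m K) = \<beta> m * (if N - m = 0 then 1 else 0)" .
  qed
  also have "\<dots> = (\<Sum>m\<in>{N}. \<beta> m)"
    by (rule sum.mono_neutral_cong_right) auto
  finally show ?thesis by simp
qed

text \<open>By Euler the full series is \<open>(1;p)_\<infinity> = 0\<close>. Its partial sums
  telescope to a product that makes their decay visible, as the Abel summation below
  requires.\<close>

lemma sum_alternating_qpoch: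
  assumes p: "norm p < 1"
  shows "(\<Sum>j\<le>J. (-1) ^ j * p ^ (j choose 2) / qpoch p p j)
         = (-1) ^ J * p ^ (Suc J choose 2) / qpoch p p J"
proof (induction J)
  case 0
  show ?case by (simp add: binomial_eq_0)
next
  case (Suc J)
  have nz: "qpoch p p k \<noteq> 0" for k using qpoch_nonzero p by blast
  have nz1: "1 - p ^ Suc k \<noteq> 0" for k using power_neq_1_of_norm_less_1[OF p, of "Suc k"] by simp
  have "Suc (Suc J) choose 2 = Suc J + (Suc J choose 2)" by (rule Suc_choose_2)
  then show ?case
    unfolding sum.atMost_Suc Suc.IH qpoch_Suc using nz[of J] nz1[of J]
    by (simp add: divide_simps power_add) (simp add: algebra_simps)
qed

lemma bailey_gamma_eq:
  "bailey_gamma p s i = (1 - p ^ (s + 2 * i)) * qpoch p p (s + i - 1)" if "s + i > 0"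
proof (cases i)
  case 0
  then obtain t where "s = Suc t" using \<open>s + i > 0\<close> by (cases s) auto
  then show ?thesis using 0 by (simp add: bailey_gamma_def qpoch_Suc)
qed (simp add: bailey_gamma_def)

text \<open>Splitting \<open>(p;p)_(K+e-1+m)\<close> into \<open>(p;p)_(K+e-1)\<close> and
  \<open>(p^(K+e);p)_m\<close> takes everything that depends on \<open>K\<close> alone out of the
  sum. What remains is a convolution with the coefficients of Euler's series, suited both to Abel
  summation and to comparison with the inner sum.\<close>

lemma bailey_alpha_eq:
  assumes "K + e > 0"
  shows "bailey_alpha p \<beta> e K = (1 - p ^ (2 * K + e)) * qpoch p p (K + e - 1)
    * (\<Sum>j\<le>K. (-1) ^ j * p ^ (j choose 2) / qpoch p p j * (qpoch (p ^ (K + e)) p (K - j) * \<beta> (K - j)))"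
proof -
  obtain t where t: "K + e = Suc t" using assms by (cases "K + e") auto
  have "bailey_alpha p \<beta> e K =
     (\<Sum>j\<le>K. \<beta> (K - j) * ((-1) ^ j * p ^ (j choose 2) / qpoch p p j
                    * bailey_gamma p (2 * (K - j) + e) j))"
    unfolding bailey_alpha_def
    by (rule sum.reindex_bij_witness[of _ "\<lambda>j. K - j" "\<lambda>j. K - j"]) auto
  also have "\<dots> = (\<Sum>j\<le>K. (1 - p ^ (2 * K + e)) * qpoch p p (K + e - 1)
     * ((-1) ^ j * p ^ (j choose 2) / qpoch p p j * (qpoch (p ^ (K + e)) p (K - j) * \<beta> (K - j))))"
  proof (rule sum.cong[OF refl])
    fix j assume j: "j \<in> {..K}"
    have "bailey_gamma p (2 * (K - j) + e) j
        = (1 - p ^ (2 * (K - j) + e + 2 * j)) * qpoch p p (2 * (K - j) + e + j - 1)"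
      using j assms by (intro bailey_gamma_eq) auto
    moreover have "2 * (K - j) + e + 2 * j = 2 * K + e" "2 * (K - j) + e + j - 1 = t + (K - j)"
      using j t by auto
    moreover have "qpoch p p (t + (K - j)) = qpoch p p t * qpoch (p ^ (K + e)) p (K - j)"
      unfolding qpoch_add t by simp
    ultimately show "\<beta> (K - j) * ((-1) ^ j * p ^ (j choose 2) / qpoch p p j
                    * bailey_gamma p (2 * (K - j) + e) j)
       = (1 - p ^ (2 * K + e)) * qpoch p p (K + e - 1)
     * ((-1) ^ j * p ^ (j choose 2) / qpoch p p j * (qpoch (p ^ (K + e)) p (K - j) * \<beta> (K - j)))"
      using t by simp
  qed
  finally show ?thesis by (simp only: sum_distrib_left)
qed

section \<open>Decay of the inverse Bailey transform\<close>

text \<open>Summation by parts pairs partial sums of \<open>d\<close> with differences of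
  \<open>g\<close>. In the application both decay geometrically, whereas the original terms with
  small \<open>j\<close> do not become small. The induction replaces \<open>g\<close> by its shift,
  hence \<open>g\<close> is arbitrary.\<close>

lemma abel_summation_convolution:
  fixes d g :: "nat \<Rightarrow> 'a :: comm_ring"
  shows "(\<Sum>j\<le>K. d j * g (K - j))
    = sum d {..K} * g 0 + (\<Sum>m<K. sum d {..K - Suc m} * (g (Suc m) - g m))"
proof (induction K arbitrary: g)
  case (Suc K)
  have "(\<Sum>j\<le>K. d j * g (Suc K - j)) = (\<Sum>j\<le>K. d j * g (Suc (K - j)))"
    by (intro sum.cong) (auto simp: Suc_diff_le)
  then have "(\<Sum>j\<le>Suc K. d j * g (Suc K - j)) = (\<Sum>j\<le>K. d j * (g \<circ> Suc) (K - j)) + d (Suc K) * g 0"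
    by simp
  also have "\<dots> = sum d {..K} * g 1
      + (\<Sum>m<K. sum d {..K - Suc m} * (g (Suc (Suc m)) - g (Suc m))) + d (Suc K) * g 0"
    unfolding Suc.IH by simp
  finally show ?case
    by (simp add: sum.lessThan_Suc_shift algebra_simps del: sum.lessThan_Suc)
qed simp

text \<open>After Abel summation each term is a partial sum of order
  \<open>\<rho> ^ (K - Suc m)\<close> times a difference of order \<open>\<rho> ^ m\<close>. There
  are \<open>Suc K\<close> terms with the boundary term, which gives the polynomial factor.\<close>

lemma norm_bailey_alpha_le:
  assumes p: "0 < norm p" "norm p < 1" and b: "norm b < 1"
  obtains C where "\<And>K. norm (bailey_alpha p (\<lambda>m. 1 / (qpoch b p m)\<^sup>2) e K)
                          \<le> C * (real (Suc K) * norm p ^ K)"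
proof -
  define \<rho> where "\<rho> = norm p"
  have \<rho>: "0 < \<rho>" "\<rho> < 1" using p by (auto simp: \<rho>_def)
  have nzp: "qpoch p p k \<noteq> 0" for k using qpoch_nonzero p(2) by blast
  have nzb: "qpoch b p k \<noteq> 0" for k using qpoch_nonzero[OF b p(2)] by blast
  obtain B where B: "B > 0" "\<And>k. norm (qpoch p p k) \<le> B" using qpoch_bounded p(2) by blast
  obtain B1 where B1: "B1 > 0" "\<And>k. norm (inverse (qpoch p p k)) \<le> B1"
    using inverse_qpoch_bounded[OF p(2), of p] nzp by blast
  obtain B2 where B2: "B2 > 0" "\<And>k. norm (inverse (qpoch b p k)) \<le> B2"
    using inverse_qpoch_bounded[OF p(2), of b] nzb by blast
  \<comment> \<open>Here 4 bounds the norm of \<open>N\<close> below, and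
    \<open>(1 - norm b)\<^sup>2\<close> bounds the denominator of the relative difference of
    \<open>g\<close> from below. In \<open>C\<close>, the division by \<open>\<rho>\<close> pays for
    the power lost in \<open>K - Suc m\<close>, and the summand 1 covers \<open>K + e = 0\<close>,
    where the transform equals 1.\<close>
  define C2 where "C2 = B * B1 * B2\<^sup>2 * 4 / (1 - norm b)\<^sup>2"
  define C where "C = 2 * B * (B1 + B1 * C2 / \<rho>) + 1"
  have C2: "C2 \<ge> 0" unfolding C2_def using B(1) B1(1) by simp
  have C: "C \<ge> 1" unfolding C_def using B(1) B1(1) C2 \<rho> by simp
  have "norm (bailey_alpha p (\<lambda>m. 1 / (qpoch b p m)\<^sup>2) e K) \<le> C * (real (Suc K) * \<rho> ^ K)" for K
  proof (cases "K + e = 0")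
    case True
    then show ?thesis using C by (simp add: bailey_alpha_def bailey_gamma_def binomial_eq_0)
  next
    case False
    then obtain t where t: "K + e = Suc t" by (cases "K + e") auto
    define d where "d j = (-1) ^ j * p ^ (j choose 2) / qpoch p p j" for j
    define g where "g m = qpoch (p ^ (K + e)) p m * (1 / (qpoch b p m)\<^sup>2)" for m
    have D: "norm (sum d {..J}) \<le> B1 * \<rho> ^ J" for J
    proof -
      have "norm (sum d {..J}) = \<rho> ^ (J choose 2) * \<rho> ^ J * norm (inverse (qpoch p p J))"
        unfolding d_def sum_alternating_qpoch[OF p(2)] Suc_choose_2
        by (simp add: norm_mult norm_power norm_divide \<rho>_def power_add norm_inverse divide_inverse)
      also have "\<dots> \<le> 1 * \<rho> ^ J * B1"
        using \<rho> B1(2)[of J] by (intro mult_mono power_le_one) auto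
      finally show ?thesis by (simp add: mult.commute)
    qed
    have gb: "norm (g m) \<le> B * B1 * B2\<^sup>2" for m
    proof -
      \<comment> \<open>Writing \<open>(p^(K+e);p)_m\<close> as a quotient of two symbols with base
        point \<open>p\<close> gives a bound that is uniform in \<open>K\<close> as well as in
        \<open>m\<close>.\<close>
      have "qpoch p p (t + m) = qpoch p p t * qpoch (p ^ (K + e)) p m"
        unfolding qpoch_add t by simp
      then have "g m = qpoch p p (t + m) * inverse (qpoch p p t) * (inverse (qpoch b p m))\<^sup>2"
        using nzp[of t] by (simp add: g_def divide_inverse power_inverse)
      then have "norm (g m) = norm (qpoch p p (t + m)) * norm (inverse (qpoch p p t))
          * (norm (inverse (qpoch b p m)))\<^sup>2"
        by (simp only: norm_mult norm_power)
      also have "\<dots> \<le> B * B1 * B2\<^sup>2"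
        using B B1 B2 by (intro mult_mono power_mono mult_nonneg_nonneg) (auto intro: less_imp_le)
      finally show ?thesis .
    qed
    have gd: "norm (g (Suc m) - g m) \<le> C2 * \<rho> ^ m" for m
    proof -
      have lo: "norm (1 - b * p ^ m) \<ge> 1 - norm b"
      proof -
        have "norm (b * p ^ m) \<le> norm b * 1"
          unfolding norm_mult norm_power using p(2) by (intro mult_left_mono power_le_one) auto
        moreover have "norm (1 - b * p ^ m) \<ge> norm (1::complex) - norm (b * p ^ m)"
          by (rule norm_triangle_ineq2)
        ultimately show ?thesis by simp
      qed
      then have nz: "1 - b * p ^ m \<noteq> 0" using b by auto
      \<comment> \<open>Both \<open>1 - p ^ (K + e) * p ^ m\<close> and
        \<open>(1 - b * p ^ m)\<^sup>2\<close> are \<open>1 + O(p ^ m)\<close>; \<open>N\<close> is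
        the cofactor of \<open>p ^ m\<close> in their difference.\<close>
      define N where "N = 2 * b - b\<^sup>2 * p ^ m - p ^ (K + e)"
      have "g (Suc m) = g m * (1 - p ^ (K + e) * p ^ m) / (1 - b * p ^ m)\<^sup>2"
        by (simp add: g_def qpoch_Suc power_mult_distrib)
      then have "g (Suc m) - g m = g m * ((1 - p ^ (K + e) * p ^ m) - (1 - b * p ^ m)\<^sup>2) / (1 - b * p ^ m)\<^sup>2"
        using nz by (simp add: field_simps)
      also have "(1 - p ^ (K + e) * p ^ m) - (1 - b * p ^ m)\<^sup>2 = p ^ m * N"
        by (simp add: N_def algebra_simps power2_eq_square)
      finally have eq: "g (Suc m) - g m = g m * (p ^ m * N) / (1 - b * p ^ m)\<^sup>2" .
      have "norm N \<le> norm (2 * b) + norm (b\<^sup>2 * p ^ m) + norm (p ^ (K + e))"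
        unfolding N_def by (intro order.trans[OF norm_triangle_ineq4] add_mono order.refl)
      also have "\<dots> \<le> 2 + 1 * 1 + 1"
        unfolding norm_mult norm_power using b p(2)
        by (intro add_mono mult_mono power_le_one) auto
      finally have N: "norm N \<le> 4" by simp
      have "norm (g (Suc m) - g m) = norm (g m) * (\<rho> ^ m * norm N) / (norm (1 - b * p ^ m))\<^sup>2"
        unfolding eq by (simp add: norm_mult norm_divide norm_power \<rho>_def)
      also have "\<dots> \<le> (B * B1 * B2\<^sup>2) * (\<rho> ^ m * 4) / (1 - norm b)\<^sup>2"
        using gb[of m] N lo b B(1) B1(1) \<rho>
        by (intro frac_le mult_mono power_mono mult_nonneg_nonneg) auto
      finally show ?thesis by (simp add: C2_def mult_ac)
    qed
    have "(\<Sum>j\<le>K. d j * g (K - j))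
       = sum d {..K} * g 0 + (\<Sum>m<K. sum d {..K - Suc m} * (g (Suc m) - g m))"
      by (rule abel_summation_convolution)
    also have "norm \<dots> \<le> norm (sum d {..K} * g 0) + (\<Sum>m<K. norm (sum d {..K - Suc m} * (g (Suc m) - g m)))"
      by (intro order.trans[OF norm_triangle_ineq] add_mono order.refl norm_sum)
    also have "\<dots> \<le> B1 * \<rho> ^ K + (\<Sum>m<K. B1 * C2 / \<rho> * \<rho> ^ K)"
    proof (intro add_mono sum_mono)
      show "norm (sum d {..K} * g 0) \<le> B1 * \<rho> ^ K" using D[of K] by (simp add: g_def)
      fix m assume "m \<in> {..<K}"
      then have K: "K = Suc (K - Suc m + m)" by auto
      have "norm (sum d {..K - Suc m} * (g (Suc m) - g m)) \<le> B1 * \<rho> ^ (K - Suc m) * (C2 * \<rho> ^ m)"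
        unfolding norm_mult using D gd B1(1) \<rho> by (intro mult_mono) auto
      also have "\<dots> = B1 * C2 / \<rho> * \<rho> ^ Suc (K - Suc m + m)"
        using \<rho> by (simp add: power_add)
      finally show "norm (sum d {..K - Suc m} * (g (Suc m) - g m)) \<le> B1 * C2 / \<rho> * \<rho> ^ K"
        unfolding K[symmetric] .
    qed
    also have "\<dots> \<le> (B1 + B1 * C2 / \<rho>) * (real (Suc K) * \<rho> ^ K)"
      using B1(1) C2 \<rho> by (simp add: algebra_simps)
    finally have S: "norm (\<Sum>j\<le>K. d j * g (K - j)) \<le> (B1 + B1 * C2 / \<rho>) * (real (Suc K) * \<rho> ^ K)" .
    have "norm (1 - p ^ (2 * K + e)) \<le> norm (1::complex) + norm (p ^ (2 * K + e))"
      by (rule norm_triangle_ineq4)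
    also have "\<dots> \<le> 1 + 1" using p by (intro add_mono) (auto simp: norm_power intro: power_le_one)
    finally have two: "norm (1 - p ^ (2 * K + e)) \<le> 2" by simp
    have "norm (bailey_alpha p (\<lambda>m. 1 / (qpoch b p m)\<^sup>2) e K)
        = norm (1 - p ^ (2 * K + e)) * norm (qpoch p p (K + e - 1)) * norm (\<Sum>j\<le>K. d j * g (K - j))"
      using False by (subst bailey_alpha_eq) (simp_all add: norm_mult d_def g_def)
    also have "\<dots> \<le> 2 * B * ((B1 + B1 * C2 / \<rho>) * (real (Suc K) * \<rho> ^ K))"
      using two B S by (intro mult_mono) auto
    also have "\<dots> \<le> 2 * B * ((B1 + B1 * C2 / \<rho>) * (real (Suc K) * \<rho> ^ K)) + real (Suc K) * \<rho> ^ K"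
      using \<rho> by simp
    also have "\<dots> = C * (real (Suc K) * \<rho> ^ K)"
      unfolding C_def by (simp only: distrib_right mult_1 mult.assoc)
    finally show ?thesis .
  qed
  then show thesis using that unfolding \<rho>_def by blast
qed

text \<open>Let \<open>N\<close> tend to infinity in \<open>bailey_inversion\<close>. Both
  denominators tend to \<open>qpoch_inf p p\<close>, and since their inverses are bounded, the norms
  of the transform form a summable majorant for Tannery's theorem.\<close>

lemma bailey_alpha_sums:
  assumes p: "norm p < 1" and lim: "\<beta> \<longlonglongrightarrow> L"
    and sm: "summable (\<lambda>K. norm (bailey_alpha p \<beta> e K))"
  shows "bailey_alpha p \<beta> e sums ((qpoch_inf p p)\<^sup>2 * L)"
proof -
  have nzp: "qpoch p p k \<noteq> 0" for k using qpoch_nonzero p by blast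
  define P where "P = qpoch_inf p p"
  have P: "P \<noteq> 0" unfolding P_def using qpoch_inf_nonzero[OF p] nzp by blast
  obtain B1 where B1: "B1 > 0" "\<And>k. norm (inverse (qpoch p p k)) \<le> B1"
    using inverse_qpoch_bounded[OF p, of p] nzp by blast
  \<comment> \<open>Extension by zero beyond \<open>N\<close> turns the finite sums into series over
    a fixed index set.\<close>
  define a where "a K N = (if K \<le> N then bailey_alpha p \<beta> e K
      / (qpoch p p (N - K) * qpoch p p (N + K + e)) else 0)" for K N
  have "((\<lambda>N. suminf (\<lambda>K. a K N)) \<longlongrightarrow> suminf (\<lambda>K. bailey_alpha p \<beta> e K / (P * P))) sequentially"
  proof (rule tannerys_theorem[THEN conjunct2, THEN conjunct2])
    fix K
    have s1: "(\<lambda>N. qpoch p p (N - K)) \<longlonglongrightarrow> P"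
      unfolding P_def by (rule filterlim_compose[OF qpoch_tendsto[OF p] filterlim_minus_const_nat_at_top])
    have s2: "(\<lambda>N. qpoch p p (N + K + e)) \<longlonglongrightarrow> P"
      unfolding P_def add.assoc by (rule LIMSEQ_ignore_initial_segment[OF qpoch_tendsto[OF p]])
    have "(\<lambda>N. bailey_alpha p \<beta> e K / (qpoch p p (N - K) * qpoch p p (N + K + e)))
        \<longlonglongrightarrow> bailey_alpha p \<beta> e K / (P * P)"
      using P by (intro tendsto_intros s1 s2) auto
    then show "(a K \<longlongrightarrow> bailey_alpha p \<beta> e K / (P * P)) sequentially"
      by (rule Lim_transform_eventually)
        (auto simp: a_def intro!: eventually_mono[OF eventually_ge_at_top[of K]])
  next
    show "summable (\<lambda>K. norm (bailey_alpha p \<beta> e K) * (B1 * B1))"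
      by (rule summable_mult2[OF sm])
    have "norm (a K N) \<le> norm (bailey_alpha p \<beta> e K) * (B1 * B1)" for K N
    proof (cases "K \<le> N")
      case True
      have "norm (a K N) = norm (bailey_alpha p \<beta> e K)
          * (norm (inverse (qpoch p p (N - K))) * norm (inverse (qpoch p p (N + K + e))))"
        using True by (simp add: a_def norm_divide norm_mult norm_inverse divide_inverse)
      also have "\<dots> \<le> norm (bailey_alpha p \<beta> e K) * (B1 * B1)"
        using B1 by (intro mult_left_mono mult_mono) auto
      finally show ?thesis .
    qed (use B1 in \<open>simp add: a_def\<close>)
    then show "\<forall>\<^sub>F (K, N) in at_top \<times>\<^sub>F sequentially. norm (a K N) \<le> norm (bailey_alpha p \<beta> e K) * (B1 * B1)"
      by (intro always_eventually) auto
  qed auto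
  moreover have "suminf (\<lambda>K. a K N) = \<beta> N" for N
  proof -
    have "suminf (\<lambda>K. a K N) = (\<Sum>K\<le>N. a K N)"
      by (rule suminf_finite) (auto simp: a_def)
    also have "\<dots> = \<beta> N"
      unfolding bailey_inversion[OF p, of \<beta> e N, symmetric] by (simp add: a_def)
    finally show ?thesis .
  qed
  ultimately have "\<beta> \<longlonglongrightarrow> suminf (\<lambda>K. bailey_alpha p \<beta> e K / (P * P))" by simp
  then have "suminf (\<lambda>K. bailey_alpha p \<beta> e K / (P * P)) = L"
    using lim LIMSEQ_unique by blast
  then have "suminf (bailey_alpha p \<beta> e) / (P * P) = L"
    using suminf_divide[OF summable_norm_cancel[OF sm], of "P * P"] by simp
  then have "suminf (bailey_alpha p \<beta> e) = P\<^sup>2 * L"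
    using P by (simp add: field_simps power2_eq_square)
  then show ?thesis
    using summable_sums[OF summable_norm_cancel[OF sm]] by (simp add: P_def)
qed

section \<open>Milne's fundamental theorem\<close>

text \<open>This is the value at \<open>u = 0\<close> of the partial fraction expansion of
  \<open>\<Prod>j (c j - b j * u / y j) / (1 - u / y j)\<close> divided by \<open>1 - u / z\<close>;
  the numerator has smaller degree than the denominator. The additional pole \<open>z\<close> makes
  the induction close: a new node \<open>y t\<close> splits each term into one with pole
  \<open>y t\<close> and one with pole \<open>z\<close>.\<close>

lemma lagrange_partial_fractions:
  fixes b c y :: "'i \<Rightarrow> 'a :: field"
  assumes "finite I" "inj_on y I" "\<And>i. i \<in> I \<Longrightarrow> y i \<noteq> 0" "z \<noteq> 0" "z \<notin> y ` I"
  shows "(\<Sum>i\<in>I. (\<Prod>j\<in>I. c j - b j * (y i / y j)) / (\<Prod>j\<in>I - {i}. 1 - y i / y j) / (1 - y i / z))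
           + (\<Prod>j\<in>I. (c j - b j * (z / y j)) / (1 - z / y j)) = prod c I"
  using assms
proof (induction I arbitrary: z rule: finite_induct)
  case (insert t I)
  let ?F = "\<lambda>i. (\<Prod>j\<in>I. c j - b j * (y i / y j)) / (\<Prod>j\<in>I - {i}. 1 - y i / y j)"
  let ?P = "\<lambda>z. \<Prod>j\<in>I. (c j - b j * (z / y j)) / (1 - z / y j)"
  have y: "y t \<noteq> 0" "z \<noteq> 0" "y t \<noteq> z" "\<And>i. i \<in> I \<Longrightarrow> y i \<noteq> 0"
    "\<And>i. i \<in> I \<Longrightarrow> y i \<noteq> z" "\<And>i. i \<in> I \<Longrightarrow> y i \<noteq> y t"
    using insert.prems insert.hyps by (auto simp: inj_on_def)
  have ynot: "y t \<notin> y ` I" "z \<notin> y ` I" using insert.prems insert.hyps by auto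
  have IH: "(\<Sum>i\<in>I. ?F i / (1 - y i / v)) = prod c I - ?P v" if "v \<noteq> 0" "v \<notin> y ` I" for v
    using insert.IH[OF _ _ that] insert.prems by (simp add: eq_diff_eq)
  \<comment> \<open>These are the coefficients at the poles \<open>y t\<close> and \<open>z\<close>
    of \<open>(c t - b t * u / y t) / ((1 - u / y t) * (1 - u / z))\<close>, whose value at
    \<open>u = 0\<close> is \<open>c t\<close>.\<close>
  define \<alpha> where "\<alpha> = (c t - b t) / (1 - y t / z)"
  define \<gamma> where "\<gamma> = (c t - b t * (z / y t)) / (1 - z / y t)"
  have \<alpha>\<gamma>: "\<alpha> + \<gamma> = c t"
    using y(1-3) unfolding \<alpha>_def \<gamma>_def by (simp add: divide_simps) (simp add: algebra_simps)
  have "(\<Prod>j\<in>insert t I. c j - b j * (y i / y j)) / (\<Prod>j\<in>insert t I - {i}. 1 - y i / y j) / (1 - y i / z)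
      = \<alpha> * (?F i / (1 - y i / y t)) + \<gamma> * (?F i / (1 - y i / z))" if i: "i \<in> I" for i
  proof -
    have "insert t I - {i} = insert t (I - {i})" using i insert.hyps by auto
    then have eq: "(\<Prod>j\<in>insert t I. c j - b j * (y i / y j)) / (\<Prod>j\<in>insert t I - {i}. 1 - y i / y j) / (1 - y i / z)
       = ?F i * ((c t - b t * (y i / y t)) / ((1 - y i / y t) * (1 - y i / z)))"
      using insert.hyps by (simp add: field_simps)
    have "(c t - b t * (y i / y t)) / ((1 - y i / y t) * (1 - y i / z))
        = \<alpha> / (1 - y i / y t) + \<gamma> / (1 - y i / z)"
      using y(1-3) y(4,5,6)[OF i] unfolding \<alpha>_def \<gamma>_def
      by (simp add: divide_simps) (simp add: algebra_simps)
    moreover have "F * (a / A + g / B) = a * (F / A) + g * (F / B)" for F a g A B :: 'a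
      by (simp add: algebra_simps)
    ultimately show ?thesis unfolding eq by (simp only:)
  qed
  then have "(\<Sum>i\<in>I. (\<Prod>j\<in>insert t I. c j - b j * (y i / y j)) / (\<Prod>j\<in>insert t I - {i}. 1 - y i / y j) / (1 - y i / z))
      = \<alpha> * (\<Sum>i\<in>I. ?F i / (1 - y i / y t)) + \<gamma> * (\<Sum>i\<in>I. ?F i / (1 - y i / z))"
    by (simp add: sum.distrib sum_distrib_left)
  also have "\<dots> = \<alpha> * (prod c I - ?P (y t)) + \<gamma> * (prod c I - ?P z)"
    unfolding IH[OF y(1) ynot(1)] IH[OF y(2) ynot(2)] ..
  finally have S: "(\<Sum>i\<in>I. (\<Prod>j\<in>insert t I. c j - b j * (y i / y j)) / (\<Prod>j\<in>insert t I - {i}. 1 - y i / y j) / (1 - y i / z))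
      = \<alpha> * (prod c I - ?P (y t)) + \<gamma> * (prod c I - ?P z)" .
  have T: "(\<Prod>j\<in>insert t I. c j - b j * (y t / y j)) / (\<Prod>j\<in>insert t I - {t}. 1 - y t / y j) / (1 - y t / z)
      = \<alpha> * ?P (y t)"
    using insert.hyps y(1) by (simp add: \<alpha>_def prod_dividef)
  have "(\<Prod>j\<in>insert t I. (c j - b j * (z / y j)) / (1 - z / y j)) = \<gamma> * ?P z"
    using insert.hyps by (simp add: \<gamma>_def)
  then have "(\<Sum>i\<in>insert t I. (\<Prod>j\<in>insert t I. c j - b j * (y i / y j)) / (\<Prod>j\<in>insert t I - {i}. 1 - y i / y j) / (1 - y i / z))
           + (\<Prod>j\<in>insert t I. (c j - b j * (z / y j)) / (1 - z / y j)) = (\<alpha> + \<gamma>) * prod c I"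
    unfolding sum.insert[OF insert.hyps] S T by (simp add: algebra_simps)
  then show ?case unfolding \<alpha>\<gamma> using insert.hyps by simp
qed simp

text \<open>Without the pole \<open>z\<close>, numerator and denominator have the same degree, and
  the value at infinity, \<open>prod b I\<close>, has to be subtracted. The induction uses the
  previous lemma with the new node \<open>y t\<close> in the role of \<open>z\<close>.\<close>

lemma lagrange_sum:
  fixes b c y :: "'i \<Rightarrow> 'a :: field"
  assumes "finite I" "inj_on y I" "\<And>i. i \<in> I \<Longrightarrow> y i \<noteq> 0"
  shows "(\<Sum>i\<in>I. (\<Prod>j\<in>I. c j - b j * (y i / y j)) / (\<Prod>j\<in>I - {i}. 1 - y i / y j)) = prod c I - prod b I"
  using assms
proof (induction I rule: finite_induct)
  case (insert t I)
  let ?F = "\<lambda>i. (\<Prod>j\<in>I. c j - b j * (y i / y j)) / (\<Prod>j\<in>I - {i}. 1 - y i / y j)"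
  let ?P = "\<Prod>j\<in>I. (c j - b j * (y t / y j)) / (1 - y t / y j)"
  have y: "y t \<noteq> 0" "\<And>i. i \<in> I \<Longrightarrow> y i \<noteq> 0" "\<And>i. i \<in> I \<Longrightarrow> y i \<noteq> y t"
    using insert.prems insert.hyps by (auto simp: inj_on_def)
  have "(\<Prod>j\<in>insert t I. c j - b j * (y i / y j)) / (\<Prod>j\<in>insert t I - {i}. 1 - y i / y j)
      = b t * ?F i + (c t - b t) * (?F i / (1 - y i / y t))" if i: "i \<in> I" for i
  proof -
    have "insert t I - {i} = insert t (I - {i})" using i insert.hyps by auto
    then have "(\<Prod>j\<in>insert t I. c j - b j * (y i / y j)) / (\<Prod>j\<in>insert t I - {i}. 1 - y i / y j)
       = ?F i * ((c t - b t * (y i / y t)) / (1 - y i / y t))"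
      using insert.hyps by (simp add: field_simps)
    moreover have "(c t - b t * (y i / y t)) / (1 - y i / y t) = b t + (c t - b t) / (1 - y i / y t)"
      using y(1) y(2,3)[OF i] by (simp add: divide_simps) (simp add: algebra_simps)
    moreover have "F * (u + v / A) = u * F + v * (F / A)" for F u v A :: 'a
      by (simp add: algebra_simps)
    ultimately show ?thesis by (simp only:)
  qed
  then have "(\<Sum>i\<in>I. (\<Prod>j\<in>insert t I. c j - b j * (y i / y j)) / (\<Prod>j\<in>insert t I - {i}. 1 - y i / y j))
     = b t * sum ?F I + (c t - b t) * (\<Sum>i\<in>I. ?F i / (1 - y i / y t))"
    by (simp add: sum.distrib sum_distrib_left)
  also have "sum ?F I = prod c I - prod b I" using insert by auto
  also have "(\<Sum>i\<in>I. ?F i / (1 - y i / y t)) = prod c I - ?P"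
    using lagrange_partial_fractions[OF \<open>finite I\<close>, of y "y t" c b] insert.prems insert.hyps y
    by (auto simp: eq_diff_eq)
  finally have S: "(\<Sum>i\<in>I. (\<Prod>j\<in>insert t I. c j - b j * (y i / y j)) / (\<Prod>j\<in>insert t I - {i}. 1 - y i / y j))
     = b t * (prod c I - prod b I) + (c t - b t) * (prod c I - ?P)" .
  have T: "(\<Prod>j\<in>insert t I. c j - b j * (y t / y j)) / (\<Prod>j\<in>insert t I - {t}. 1 - y t / y j)
      = (c t - b t) * ?P"
    using insert.hyps y(1) by (simp add: prod_dividef)
  show ?case unfolding sum.insert[OF insert.hyps] S T using insert.hyps by (simp add: algebra_simps)
qed simp

text \<open>Raising one entry \<open>k i\<close> changes only those factors of a Vandermonde product
  whose pair contains \<open>i\<close>; symmetry merges the pairs \<open>(r, i)\<close> and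
  \<open>(i, s)\<close>.\<close>

lemma prod_pairs_involving:
  fixes h :: "nat \<Rightarrow> nat \<Rightarrow> 'a :: comm_monoid_mult"
  assumes i: "i \<in> {1..n}" and sym: "\<And>r s. h r s = h s r"
    and one: "\<And>r s. r \<noteq> i \<Longrightarrow> s \<noteq> i \<Longrightarrow> h r s = 1"
  shows "(\<Prod>r\<in>{1..n}. \<Prod>s\<in>{r<..n}. h r s) = (\<Prod>j\<in>{1..n} - {i}. h i j)"
proof -
  have "(\<Prod>r\<in>{1..n}. \<Prod>s\<in>{r<..n}. h r s)
      = (\<Prod>r\<in>{1..n}. \<Prod>s\<in>{r<..n}. (if r = i then h i s else 1) * (if s = i then h i r else 1))"
    by (intro prod.cong refl) (auto simp: one, metis sym)
  also have "\<dots> = (\<Prod>r\<in>{1..n}. if r = i then (\<Prod>s\<in>{i<..n}. h i s) else 1)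
       * (\<Prod>r\<in>{1..n}. if r < i then h i r else 1)"
    unfolding prod.distrib using i by (intro arg_cong2[of _ _ _ _ "(*)"] prod.cong) auto
  also have "\<dots> = (\<Prod>s\<in>{i<..n}. h i s) * (\<Prod>r\<in>{r\<in>{1..n}. r < i}. h i r)"
    using i by (subst prod.inter_filter) auto
  also have "\<dots> = (\<Prod>j\<in>{i<..n} \<union> {r\<in>{1..n}. r < i}. h i j)"
    by (subst prod.union_disjoint) auto
  also have "{i<..n} \<union> {r\<in>{1..n}. r < i} = {1..n} - {i}" using i by auto
  finally show ?thesis .
qed

section \<open>Multi-indices of given size and Milne's sum over them\<close>

definition multi_indices_eq :: "nat \<Rightarrow> nat \<Rightarrow> (nat \<Rightarrow> nat) set" where
  "multi_indices_eq n N = {k \<in> multi_indices n. msize n k = N}"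

lemma le_msize: "r \<in> {1..n} \<Longrightarrow> k r \<le> msize n k"
  unfolding msize_def by (rule member_le_sum) auto

lemma multi_indices_eq_subset: "multi_indices_eq n N \<subseteq> {1..n} \<rightarrow>\<^sub>E {..N}"
proof
  fix k assume "k \<in> multi_indices_eq n N"
  then show "k \<in> {1..n} \<rightarrow>\<^sub>E {..N}"
    using le_msize[of _ n k] by (auto simp: multi_indices_eq_def multi_indices_def PiE_iff)
qed

lemma finite_multi_indices_eq: "finite (multi_indices_eq n N)"
  by (rule finite_subset[OF multi_indices_eq_subset]) (auto intro: finite_PiE)

text \<open>Polynomial growth in \<open>N\<close> is all that matters, since the terms decay
  geometrically.\<close>

lemma card_multi_indices_eq_le: "card (multi_indices_eq n N) \<le> Suc N ^ n"
  using card_mono[OF _ multi_indices_eq_subset[of n N]] by (simp add: card_PiE finite_PiE)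

lemma multi_indices_eq_0: "multi_indices_eq n 0 = {\<lambda>r\<in>{1..n}. 0}"
  by (auto simp: multi_indices_eq_def multi_indices_def msize_def PiE_iff extensional_def)

lemma msize_update_Suc:
  assumes "i \<in> {1..n}"
  shows "msize n (k(i := Suc (k i))) = Suc (msize n k)"
proof -
  have "msize n (k(i := Suc (k i))) = Suc (k i) + sum k ({1..n} - {i})"
    unfolding msize_def using assms by (subst sum.remove[of _ i]) (auto intro!: sum.cong)
  also have "\<dots> = Suc (msize n k)"
    unfolding msize_def using assms by (subst sum.remove[of _ i k]) auto
  finally show ?thesis .
qed

text \<open>A homogeneous form of the summand: \<open>c = 1\<close> gives Milne's fundamental theorem, while
  \<open>c = 0\<close>, \<open>a = 1\<close> replaces the limit in which all numerator parameters tend to infinity.\<close>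
definition milne_term ::
    "complex \<Rightarrow> nat \<Rightarrow> (nat \<Rightarrow> complex) \<Rightarrow> (nat \<Rightarrow> complex) \<Rightarrow> (nat \<Rightarrow> complex) \<Rightarrow> (nat \<Rightarrow> nat) \<Rightarrow> complex"
  where
  "milne_term p n x c a k =
     (\<Prod>r\<in>{1..n}. \<Prod>s\<in>{r<..n}. (x r * p ^ k r - x s * p ^ k s) / (x r - x s))
     * (\<Prod>r\<in>{1..n}. \<Prod>s\<in>{1..n}. (\<Prod>i<k r. c s - a s * (x r / x s) * p ^ i)
                                  / qpoch (p * (x r / x s)) p (k r))"

locale milne_params =
  fixes p :: complex and n :: nat and x :: "nat \<Rightarrow> complex"
  assumes p_pos: "0 < norm p" and p_less_1: "norm p < 1"
    and x_nz: "\<And>r. r \<in> {1..n} \<Longrightarrow> x r \<noteq> 0"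
    and x_inj: "inj_on x {1..n}"
    and qpoch_nz: "\<And>r s k. r \<in> {1..n} \<Longrightarrow> s \<in> {1..n} \<Longrightarrow> qpoch (p * (x r / x s)) p k \<noteq> 0"
begin

lemma p_nz: "p \<noteq> 0"
  using p_pos by auto

lemma shifted_ratio_nz:
  assumes "r \<in> {1..n}" "s \<in> {1..n}"
  shows "1 - x r / x s * p ^ Suc d \<noteq> 0"
proof -
  have "p * (x r / x s) * p ^ d = x r / x s * p ^ Suc d" by simp
  then have "qpoch (p * (x r / x s)) p (Suc d) = qpoch (p * (x r / x s)) p d * (1 - x r / x s * p ^ Suc d)"
    by (simp only: qpoch_Suc)
  then show ?thesis using qpoch_nz[OF assms, of "Suc d"] by (metis mult_zero_right)
qed

text \<open>A coincidence of two shifted nodes gives \<open>x r / x s * p ^ d = 1\<close> for some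
  \<open>d\<close>. For \<open>d = 0\<close> injectivity of \<open>x\<close> forbids it, for
  \<open>d > 0\<close> the nonvanishing denominators do. Thus the Lagrange sums apply at the nodes
  \<open>x r * p ^ k r\<close> for every \<open>k\<close>.\<close>

lemma shifted_inj: "inj_on (\<lambda>r. x r * p ^ k r) {1..n}"
proof -
  have *: "x r * p ^ a \<noteq> x s * p ^ b" if "r \<in> {1..n}" "s \<in> {1..n}" "r \<noteq> s" "b \<le> a" for r s a b
  proof
    assume eq: "x r * p ^ a = x s * p ^ b"
    obtain d where d: "a = b + d" using le_Suc_ex[OF \<open>b \<le> a\<close>] by auto
    have "(x r * p ^ d) * p ^ b = x s * p ^ b"
      unfolding eq[symmetric] d power_add by (simp only: mult_ac)
    then have eq': "x r * p ^ d = x s"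
      using p_nz by simp
    show False
    proof (cases d)
      case 0
      then have "x r = x s" using eq' by simp
      then show ?thesis using inj_onD[OF x_inj] that(1-3) by blast
    next
      case (Suc d')
      have "x r / x s * p ^ Suc d' = 1" using eq' x_nz[OF that(2)] by (simp add: Suc)
      then show ?thesis using shifted_ratio_nz[OF that(1,2), of d'] by (simp only: diff_self)
    qed
  qed
  show ?thesis
  proof (rule inj_onI, rule ccontr)
    fix r s assume rs: "r \<in> {1..n}" "s \<in> {1..n}" "r \<noteq> s" and eq: "x r * p ^ k r = x s * p ^ k s"
    show False
    proof (cases "k s \<le> k r")
      case True
      then show ?thesis using *[OF rs True] eq by (simp only: not_True_eq_False)
    next
      case False
      then have "k r \<le> k s" by simp
      then show ?thesis using *[OF rs(2,1) rs(3)[symmetric]] eq[symmetric] by (simp only: not_True_eq_False)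
    qed
  qed
qed

lemma milne_term_update:
  fixes k :: "nat \<Rightarrow> nat"
  assumes i: "i \<in> {1..n}"
  defines "y \<equiv> \<lambda>r. x r * p ^ k r"
  shows "milne_term p n x c a (k(i := Suc (k i))) = milne_term p n x c a k
     * (\<Prod>j\<in>{1..n} - {i}. (p * y i - y j) / (y i - y j))
     * (\<Prod>s\<in>{1..n}. (c s - a s * (x i / x s) * p ^ k i) / (1 - x i / x s * p ^ Suc (k i)))"
proof -
  define k' where "k' = k(i := Suc (k i))"
  have y_neq: "y r \<noteq> y s" if "r \<in> {1..n}" "s \<in> {1..n}" "r \<noteq> s" for r s
    using inj_onD[OF shifted_inj[of k]] that unfolding y_def by blast
  \<comment> \<open>\<open>h r s\<close> is the quotient of the new by the old Vandermonde factor,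
    set to 1 when neither index is \<open>i\<close>. It is symmetric because numerator and
    denominator both change sign.\<close>
  define h where "h r s = (if r \<noteq> i \<and> s \<noteq> i then 1 else
      (x r * p ^ k' r - x s * p ^ k' s) / (y r - y s))" for r s
  have flip: "(t - u) / (v - w) = (u - t) / (w - v)" for t u v w :: complex
    by (metis minus_diff_eq minus_divide_divide)
  have hsym: "h r s = h s r" for r s
    unfolding h_def by (subst flip) (simp only: conj_commute)
  have "(\<Prod>r\<in>{1..n}. \<Prod>s\<in>{r<..n}. (x r * p ^ k' r - x s * p ^ k' s) / (x r - x s))
     = (\<Prod>r\<in>{1..n}. \<Prod>s\<in>{r<..n}. (x r * p ^ k r - x s * p ^ k s) / (x r - x s) * h r s)"
  proof (intro prod.cong refl)
    fix r s assume rs: "r \<in> {1..n}" "s \<in> {r<..n}"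
    then have "y r - y s \<noteq> 0" using y_neq[of r s] by auto
    then show "(x r * p ^ k' r - x s * p ^ k' s) / (x r - x s)
        = (x r * p ^ k r - x s * p ^ k s) / (x r - x s) * h r s"
      by (auto simp: h_def k'_def y_def)
  qed
  also have "\<dots> = (\<Prod>r\<in>{1..n}. \<Prod>s\<in>{r<..n}. (x r * p ^ k r - x s * p ^ k s) / (x r - x s))
      * (\<Prod>j\<in>{1..n} - {i}. h i j)"
    unfolding prod.distrib
    by (intro arg_cong2[of _ _ _ _ "(*)"] refl prod_pairs_involving[OF i] hsym) (simp add: h_def)
  also have "(\<Prod>j\<in>{1..n} - {i}. h i j) = (\<Prod>j\<in>{1..n} - {i}. (p * y i - y j) / (y i - y j))"
    by (intro prod.cong) (auto simp: h_def k'_def y_def mult_ac)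
  finally have V: "(\<Prod>r\<in>{1..n}. \<Prod>s\<in>{r<..n}. (x r * p ^ k' r - x s * p ^ k' s) / (x r - x s))
     = (\<Prod>r\<in>{1..n}. \<Prod>s\<in>{r<..n}. (x r * p ^ k r - x s * p ^ k s) / (x r - x s))
      * (\<Prod>j\<in>{1..n} - {i}. (p * y i - y j) / (y i - y j))" .
  let ?R = "\<lambda>k r. \<Prod>s\<in>{1..n}. (\<Prod>i<k r. c s - a s * (x r / x s) * p ^ i) / qpoch (p * (x r / x s)) p (k r)"
  have "(\<Prod>r\<in>{1..n}. ?R k' r) = ?R k' i * (\<Prod>r\<in>{1..n}-{i}. ?R k' r)"
    using i by (subst prod.remove[of _ i]) auto
  also have "(\<Prod>r\<in>{1..n}-{i}. ?R k' r) = (\<Prod>r\<in>{1..n}-{i}. ?R k r)"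
    by (intro prod.cong) (auto simp: k'_def)
  also have "?R k' i = ?R k i * (\<Prod>s\<in>{1..n}. (c s - a s * (x i / x s) * p ^ k i) / (1 - x i / x s * p ^ Suc (k i)))"
    unfolding prod.distrib[symmetric] by (intro prod.cong) (auto simp: k'_def qpoch_Suc mult_ac)
  also have "?R k i * (\<Prod>s\<in>{1..n}. (c s - a s * (x i / x s) * p ^ k i) / (1 - x i / x s * p ^ Suc (k i)))
      * (\<Prod>r\<in>{1..n}-{i}. ?R k r) = (?R k i * (\<Prod>r\<in>{1..n}-{i}. ?R k r))
      * (\<Prod>s\<in>{1..n}. (c s - a s * (x i / x s) * p ^ k i) / (1 - x i / x s * p ^ Suc (k i)))"
    by (simp only: mult_ac)
  also have "?R k i * (\<Prod>r\<in>{1..n}-{i}. ?R k r) = (\<Prod>r\<in>{1..n}. ?R k r)"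
    using i by (subst (2) prod.remove[of _ i]) auto
  finally show ?thesis
    unfolding milne_term_def k'_def[symmetric] V by (simp only: mult_ac)
qed

text \<open>The factor on the left is the \<open>i\<close>-th term of \<open>lagrange_sum\<close> at
  the nodes \<open>y'\<close> with all \<open>c j\<close> equal to 1 and
  \<open>b j = p ^ k' j\<close>; on the right it is the \<open>i\<close>-th term at the nodes
  \<open>y\<close> with \<open>b j = a j * p ^ k j\<close>. They match because the left numerator
  cancels exactly the denominator factors gained by raising \<open>k i\<close>.\<close>

lemma milne_term_recurrence:
  fixes k :: "nat \<Rightarrow> nat"
  assumes i: "i \<in> {1..n}"
  defines "k' \<equiv> k(i := Suc (k i))"
  defines "y \<equiv> \<lambda>r. x r * p ^ k r" and "y' \<equiv> \<lambda>r. x r * p ^ k' r"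
  shows "(\<Prod>j\<in>{1..n}. 1 - p ^ k' j * (y' i / y' j)) / (\<Prod>j\<in>{1..n} - {i}. 1 - y' i / y' j)
           * milne_term p n x c a k'
       = (\<Prod>j\<in>{1..n}. c j - a j * p ^ k j * (y i / y j)) / (\<Prod>j\<in>{1..n} - {i}. 1 - y i / y j)
           * milne_term p n x c a k"
proof -
  have y_neq: "y r \<noteq> y s" "y' r \<noteq> y' s" if "r \<in> {1..n}" "s \<in> {1..n}" "r \<noteq> s" for r s
    using inj_onD[OF shifted_inj[of k]] inj_onD[OF shifted_inj[of k']] that
    unfolding y_def y'_def by blast+
  have y_nz: "y r \<noteq> 0" "y' r \<noteq> 0" if "r \<in> {1..n}" for r
    using x_nz[OF that] p_nz by (auto simp: y_def y'_def)
  define A where "A = (\<Prod>s\<in>{1..n}. 1 - x i / x s * p ^ Suc (k i))"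
  have A: "A \<noteq> 0" unfolding A_def using shifted_ratio_nz[OF i] by auto
  \<comment> \<open>Since \<open>p ^ k' j / y' j = 1 / x j\<close>, the choice of \<open>b j\<close>
    removes all entries of the multi-index except the \<open>i\<close>-th.\<close>
  have n1: "(\<Prod>j\<in>{1..n}. 1 - p ^ k' j * (y' i / y' j)) = A"
    unfolding A_def using p_nz by (intro prod.cong) (auto simp: y'_def k'_def)
  have n2: "(\<Prod>j\<in>{1..n}. c j - a j * p ^ k j * (y i / y j)) = (\<Prod>s\<in>{1..n}. c s - a s * (x i / x s) * p ^ k i)"
    using p_nz by (intro prod.cong) (auto simp: y_def)
  have "(\<Prod>j\<in>{1..n} - {i}. (p * y i - y j) / (y i - y j)) / (\<Prod>j\<in>{1..n} - {i}. 1 - y' i / y' j)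
      = 1 / (\<Prod>j\<in>{1..n} - {i}. 1 - y i / y j)"
  proof -
    have "(p * y i - y j) / (y i - y j) / (1 - y' i / y' j) = 1 / (1 - y i / y j)"
      if j: "j \<in> {1..n} - {i}" for j
    proof -
      have e: "y' i = p * y i" "y' j = y j" using j by (auto simp: y_def y'_def k'_def)
      have "p * y i \<noteq> y j" using y_neq(2)[of i j] i j e by auto
      then show ?thesis
        unfolding e using y_neq(1)[of i j] y_nz(1)[of i] y_nz(1)[of j] i j
        by (simp add: divide_simps) (simp add: algebra_simps)
    qed
    then have "(\<Prod>j\<in>{1..n} - {i}. (p * y i - y j) / (y i - y j) / (1 - y' i / y' j))
        = (\<Prod>j\<in>{1..n} - {i}. 1 / (1 - y i / y j))" by (intro prod.cong) auto
    then show ?thesis by (simp only: prod_dividef prod.neutral_const)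
  qed
  moreover have "milne_term p n x c a k' = milne_term p n x c a k
     * (\<Prod>j\<in>{1..n} - {i}. (p * y i - y j) / (y i - y j))
     * ((\<Prod>s\<in>{1..n}. c s - a s * (x i / x s) * p ^ k i) / A)"
    unfolding k'_def milne_term_update[OF i] y_def A_def prod_dividef ..
  moreover have "V / D * (W * X * (T / V)) = T / Y * W" if "V \<noteq> 0" "X / D = 1 / Y" for V D W X T Y :: complex
  proof -
    have "V / D * (W * X * (T / V)) = W * T * (X / D)" using that(1) by (simp add: mult_ac)
    then show ?thesis unfolding that(2) by (simp add: mult_ac)
  qed
  ultimately show ?thesis
    unfolding n1 n2 using A by presburger
qed

text \<open>The factor \<open>1 - p ^ Suc N\<close> is written as a Lagrange sum over
  \<open>i\<close> for each \<open>k\<close> of size \<open>Suc N\<close>. The recurrence moves each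
  pair \<open>(k, i)\<close> to size \<open>N\<close> by lowering \<open>k i\<close>, and there the
  sum over \<open>i\<close> is again a Lagrange sum, with value
  \<open>prod c {1..n} - prod a {1..n} * p ^ N\<close>.\<close>

theorem milne_fundamental:
  "(\<Sum>k\<in>multi_indices_eq n N. milne_term p n x c a k)
     = (\<Prod>i<N. prod c {1..n} - prod a {1..n} * p ^ i) / qpoch p p N"
proof (induction N)
  case 0
  have "(\<Prod>r\<in>{1..n}. \<Prod>s\<in>{r<..n}. (x r - x s) / (x r - x s)) = 1"
  proof (intro prod.neutral ballI)
    fix r s assume "r \<in> {1..n}" "s \<in> {r<..n}"
    then have "x r \<noteq> x s" using inj_onD[OF x_inj, of r s] by auto
    then show "(x r - x s) / (x r - x s) = 1" by simp
  qed
  then show ?case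
    unfolding multi_indices_eq_0 by (simp add: milne_term_def)
next
  case (Suc N)
  let ?W = "milne_term p n x c a"
  let ?U = "\<lambda>k i. (\<Prod>j\<in>{1..n}. 1 - p ^ k j * ((x i * p ^ k i) / (x j * p ^ k j)))
      / (\<Prod>j\<in>{1..n} - {i}. 1 - (x i * p ^ k i) / (x j * p ^ k j))"
  let ?Y = "\<lambda>k i. (\<Prod>j\<in>{1..n}. c j - a j * p ^ k j * ((x i * p ^ k i) / (x j * p ^ k j)))
      / (\<Prod>j\<in>{1..n} - {i}. 1 - (x i * p ^ k i) / (x j * p ^ k j))"
  have y_nz: "x r * p ^ k r \<noteq> 0" if "r \<in> {1..n}" for r k
    using x_nz[OF that] p_nz by auto
  have U: "(\<Sum>i\<in>{1..n}. ?U k i) = 1 - p ^ msize n k" for k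
    using lagrange_sum[of "{1..n}" "\<lambda>r. x r * p ^ k r" "\<lambda>_. 1" "\<lambda>j. p ^ k j"] shifted_inj[of k] y_nz
    by (simp add: msize_def power_sum)
  have Y: "(\<Sum>i\<in>{1..n}. ?Y k i) = prod c {1..n} - prod a {1..n} * p ^ msize n k" for k
    using lagrange_sum[of "{1..n}" "\<lambda>r. x r * p ^ k r" c "\<lambda>j. a j * p ^ k j"] shifted_inj[of k] y_nz
    by (simp add: msize_def power_sum prod.distrib)
  \<comment> \<open>A pair with \<open>k i = 0\<close> has no predecessor; it contributes nothing
    because the factor \<open>j = i\<close> vanishes.\<close>
  have U0: "?U k i = 0" if "i \<in> {1..n}" "k i = 0" for k i
  proof -
    have "1 - p ^ k i * ((x i * p ^ k i) / (x i * p ^ k i)) = 0"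
      using that y_nz[OF that(1), of k] x_nz[OF that(1)] by simp
    then have "(\<Prod>j\<in>{1..n}. 1 - p ^ k j * ((x i * p ^ k i) / (x j * p ^ k j))) = 0"
      by (intro prod_zero bexI[OF _ that(1)]) auto
    then show ?thesis by simp
  qed
  define S where "S = Sigma (multi_indices_eq n (Suc N)) (\<lambda>k. {i \<in> {1..n}. k i > 0})"
  have "(1 - p ^ Suc N) * (\<Sum>k\<in>multi_indices_eq n (Suc N). ?W k)
      = (\<Sum>k\<in>multi_indices_eq n (Suc N). \<Sum>i\<in>{1..n}. ?U k i * ?W k)"
    unfolding sum_distrib_left sum_distrib_right[symmetric] U
    by (intro sum.cong) (auto simp: multi_indices_eq_def)
  also have "\<dots> = (\<Sum>k\<in>multi_indices_eq n (Suc N). \<Sum>i\<in>{i \<in> {1..n}. k i > 0}. ?U k i * ?W k)"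
  proof (rule sum.cong[OF refl], rule sum.mono_neutral_right)
    fix k :: "nat \<Rightarrow> nat"
    show "\<forall>i\<in>{1..n} - {i \<in> {1..n}. 0 < k i}. ?U k i * ?W k = 0"
    proof
      fix i assume "i \<in> {1..n} - {i \<in> {1..n}. 0 < k i}"
      then have "?U k i = 0" by (intro U0) auto
      then show "?U k i * ?W k = 0" by (simp only: mult_zero_left)
    qed
  qed auto
  also have "\<dots> = (\<Sum>(k,i)\<in>S. ?U k i * ?W k)"
    unfolding S_def by (rule sum.Sigma) (auto simp: finite_multi_indices_eq)
  also have "\<dots> = (\<Sum>(k,i)\<in>multi_indices_eq n N \<times> {1..n}. ?Y k i * ?W k)"
  proof (rule sum.reindex_bij_witness[of _ "\<lambda>(k,i). (k(i := Suc (k i)), i)" "\<lambda>(k,i). (k(i := k i - 1), i)"])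
    fix z assume z: "z \<in> S"
    obtain k i where zki: "z = (k, i)" by (cases z)
    have ki: "i \<in> {1..n}" "k i > 0" "k \<in> multi_indices n" "msize n k = Suc N"
      using z by (auto simp: zki S_def multi_indices_eq_def)
    let ?k = "k(i := k i - 1)"
    have k: "?k(i := Suc (?k i)) = k" using ki by auto
    show "(case case z of (k, i) \<Rightarrow> (k(i := k i - 1), i) of (k, i) \<Rightarrow> (k(i := Suc (k i)), i)) = z"
      using k by (simp add: zki)
    have "msize n ?k = N" using msize_update_Suc[OF ki(1), of ?k] ki(4) unfolding k by simp
    moreover have "?k \<in> multi_indices n"
      using ki(1,3) by (auto simp: multi_indices_def PiE_iff extensional_def)
    ultimately show "(case z of (k, i) \<Rightarrow> (k(i := k i - 1), i)) \<in> multi_indices_eq n N \<times> {1..n}"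
      using ki(1) by (simp add: zki multi_indices_eq_def)
    have "?U k i * ?W k = ?Y ?k i * ?W ?k"
      using milne_term_recurrence[OF ki(1), of ?k c a] unfolding k .
    then show "(case case z of (k, i) \<Rightarrow> (k(i := k i - 1), i) of (k, i) \<Rightarrow> ?Y k i * ?W k)
        = (case z of (k, i) \<Rightarrow> ?U k i * ?W k)"
      unfolding zki prod.case by (rule sym)
  next
    fix z assume z: "z \<in> multi_indices_eq n N \<times> {1..n}"
    obtain k i where zki: "z = (k, i)" by (cases z)
    have ki: "i \<in> {1..n}" "k \<in> multi_indices n" "msize n k = N"
      using z by (auto simp: zki multi_indices_eq_def)
    show "(case case z of (k, i) \<Rightarrow> (k(i := Suc (k i)), i) of (k, i) \<Rightarrow> (k(i := k i - 1), i)) = z"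
      by (simp add: zki)
    have "k(i := Suc (k i)) \<in> multi_indices n"
      using ki(1,2) by (auto simp: multi_indices_def PiE_iff extensional_def)
    then show "(case z of (k, i) \<Rightarrow> (k(i := Suc (k i)), i)) \<in> S"
      using ki msize_update_Suc[OF ki(1), of k] by (simp add: zki S_def multi_indices_eq_def)
  qed
  also have "\<dots> = (\<Sum>k\<in>multi_indices_eq n N. \<Sum>i\<in>{1..n}. ?Y k i * ?W k)"
    by (rule sum.cartesian_product[symmetric])
  also have "\<dots> = (prod c {1..n} - prod a {1..n} * p ^ N) * (\<Sum>k\<in>multi_indices_eq n N. ?W k)"
    unfolding sum_distrib_left sum_distrib_right[symmetric] Y
    by (intro sum.cong) (auto simp: multi_indices_eq_def)
  finally have rec: "(1 - p ^ Suc N) * (\<Sum>k\<in>multi_indices_eq n (Suc N). ?W k)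
     = (prod c {1..n} - prod a {1..n} * p ^ N) * (\<Sum>k\<in>multi_indices_eq n N. ?W k)" .
  have nz: "1 - p ^ Suc N \<noteq> 0" using power_neq_1_of_norm_less_1[OF p_less_1, of "Suc N"] by simp
  have "(\<Sum>k\<in>multi_indices_eq n (Suc N). ?W k)
     = (prod c {1..n} - prod a {1..n} * p ^ N) * (\<Sum>k\<in>multi_indices_eq n N. ?W k) / (1 - p ^ Suc N)"
    unfolding rec[symmetric] using nz by simp
  then show ?case
    unfolding Suc.IH by (simp add: qpoch_Suc mult_ac)
qed

end

section \<open>Reduction to one dimension and absolute convergence\<close>

lemma sum_upper_triangle:
  fixes g :: "nat \<Rightarrow> 'a :: comm_semiring_1"
  shows "(\<Sum>r\<in>{1..n}. \<Sum>s\<in>{r<..n}. g s) = (\<Sum>s\<in>{1..n}. of_nat (s - 1) * g s)"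
proof -
  have "(\<Sum>r\<in>{1..n}. \<Sum>s\<in>{r<..n}. g s) = (\<Sum>s\<in>{1..n}. \<Sum>r\<in>{1..<s}. g s)"
    unfolding sum.Sigma[OF finite_atLeastAtMost ballI[OF finite_greaterThanAtMost]]
      sum.Sigma[OF finite_atLeastAtMost ballI[OF finite_atLeastLessThan]]
    by (rule sum.reindex_bij_witness[of _ "\<lambda>(a,b). (b,a)" "\<lambda>(a,b). (b,a)"]) auto
  then show ?thesis by simp
qed

text \<open>Every index lies in \<open>n - 1\<close> pairs.\<close>

lemma sum_pairs:
  fixes f :: "nat \<Rightarrow> real"
  shows "(\<Sum>r\<in>{1..n}. \<Sum>s\<in>{r<..n}. f r + f s) = (real n - 1) * sum f {1..n}"
proof -
  have "(\<Sum>r\<in>{1..n}. \<Sum>s\<in>{r<..n}. f r + f s) = (\<Sum>r\<in>{1..n}. real (n - r) * f r) + (\<Sum>s\<in>{1..n}. real (s - 1) * f s)"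
    by (simp only: sum.distrib sum_upper_triangle) simp
  also have "\<dots> = (\<Sum>r\<in>{1..n}. (real n - 1) * f r)"
    unfolding sum.distrib[symmetric] by (intro sum.cong) (auto simp: of_nat_diff algebra_simps)
  finally show ?thesis by (simp add: sum_distrib_left)
qed

text \<open>The left side keeps the shape in which \<open>milne_term\<close> with
  \<open>c = 0\<close>, \<open>a = 1\<close> produces it, so that it can be rewritten
  directly.\<close>

lemma prod_minus_geometric:
  fixes z p :: complex
  shows "(\<Prod>i<k. 0 - 1 * z * p ^ i) = (-1) ^ k * z ^ k * p ^ (k choose 2)"
  by (induction k) (simp_all add: binomial_eq_0 Suc_choose_2 power_add del: binomial_Suc_Suc)

lemma summable_power_times_geometric:
  fixes \<rho> :: real
  assumes "0 < \<rho>" "\<rho> < 1"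
  shows "summable (\<lambda>K. real (Suc K) ^ m * \<rho> ^ K)"
proof -
  have L: "(\<lambda>K. 1 + 1 / real (Suc K)) \<longlonglongrightarrow> 1 + 0"
    by (rule tendsto_add[OF tendsto_const LIMSEQ_Suc[OF lim_1_over_n]])
  have "(\<lambda>K. (1 + 1 / real (Suc K)) ^ m * \<rho>) \<longlonglongrightarrow> (1 + 0) ^ m * \<rho>"
    by (rule tendsto_mult[OF tendsto_power[OF L] tendsto_const])
  moreover have "(1 + 0) ^ m * \<rho> < (1 + \<rho>) / 2" using assms by simp
  ultimately have "eventually (\<lambda>K. (1 + 1 / real (Suc K)) ^ m * \<rho> < (1 + \<rho>) / 2) sequentially"
    by (rule order_tendstoD)
  then obtain N where N: "\<And>K. K \<ge> N \<Longrightarrow> (1 + 1 / real (Suc K)) ^ m * \<rho> < (1 + \<rho>) / 2"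
    by (auto simp: eventually_sequentially)
  show ?thesis
  proof (rule summable_ratio_test[of "(1 + \<rho>) / 2" N])
    show "(1 + \<rho>) / 2 < 1" using assms by simp
    fix K assume "N \<le> K"
    have "real (Suc (Suc K)) = real (Suc K) * (1 + 1 / real (Suc K))"
      by (simp add: field_simps)
    then have "real (Suc (Suc K)) ^ m * \<rho> ^ Suc K
        = ((1 + 1 / real (Suc K)) ^ m * \<rho>) * (real (Suc K) ^ m * \<rho> ^ K)"
      by (simp only: power_mult_distrib power_Suc mult_ac)
    also have "\<dots> \<le> (1 + \<rho>) / 2 * (real (Suc K) ^ m * \<rho> ^ K)"
      using N[OF \<open>N \<le> K\<close>] assms by (intro mult_right_mono) auto
    finally show "norm (real (Suc (Suc K)) ^ m * \<rho> ^ Suc K) \<le> (1 + \<rho>) / 2 * norm (real (Suc K) ^ m * \<rho> ^ K)"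
      using assms by simp
  qed
qed

text \<open>The bound depends on the size only, and at most \<open>Suc K ^ n\<close> multi-indices
  have size \<open>K\<close>. This gives absolute summability over the disjoint union of the size
  classes, and then the sum may be taken class by class.\<close>

lemma has_sum_multi_indices:
  fixes f :: "(nat \<Rightarrow> nat) \<Rightarrow> complex"
  assumes bound: "\<And>k. k \<in> multi_indices n \<Longrightarrow> norm (f k) \<le> D (msize n k)"
    and sm: "summable (\<lambda>K. real (Suc K) ^ n * D K)"
    and S: "\<And>K. (\<Sum>k\<in>multi_indices_eq n K. f k) = S K"
    and D: "\<And>K. D K \<ge> 0"
  shows "(f has_sum suminf S) (multi_indices n)"
proof -
  have fiber: "(\<Sum>k\<in>multi_indices_eq n K. norm (f k)) \<le> real (Suc K) ^ n * D K" for K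
  proof -
    have "(\<Sum>k\<in>multi_indices_eq n K. norm (f k)) \<le> (\<Sum>k\<in>multi_indices_eq n K. D K)"
      using bound by (intro sum_mono) (auto simp: multi_indices_eq_def)
    also have "\<dots> = real (card (multi_indices_eq n K)) * D K" by simp
    also have "\<dots> \<le> real (Suc K ^ n) * D K"
      by (intro mult_right_mono of_nat_mono card_multi_indices_eq_le D)
    finally show ?thesis by simp
  qed
  have sum_norm: "summable (\<lambda>K. \<Sum>k\<in>multi_indices_eq n K. norm (f k))"
    by (rule summable_comparison_test'[OF sm, of 0]) (use fiber in \<open>auto simp: sum_nonneg\<close>)
  have "norm (S K) \<le> (\<Sum>k\<in>multi_indices_eq n K. norm (f k))" for K
    unfolding S[symmetric] by (rule norm_sum)
  then have S_norm: "summable (\<lambda>K. norm (S K))"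
    by (intro summable_comparison_test'[OF sum_norm, of 0]) auto
  have sums: "(S has_sum suminf S) UNIV"
    by (rule norm_summable_imp_has_sum[OF S_norm summable_sums[OF summable_norm_cancel[OF S_norm]]])
  let ?g = "\<lambda>z :: nat \<times> (nat \<Rightarrow> nat). f (snd z)"
  have "(\<lambda>z. norm (?g z)) summable_on Sigma UNIV (multi_indices_eq n)"
    unfolding Infinite_Sum.abs_summable_on_Sigma_iff
  proof (intro conjI ballI)
    fix K
    show "(\<lambda>y. norm (?g (K, y))) summable_on multi_indices_eq n K"
      by (rule summable_on_finite[OF finite_multi_indices_eq])
  next
    have "(\<lambda>K. \<Sum>k\<in>multi_indices_eq n K. norm (f k)) summable_on UNIV"
      by (rule norm_summable_imp_summable_on) (use sum_norm in \<open>simp add: sum_nonneg\<close>)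
    then show "(\<lambda>K. norm (\<Sum>\<^sub>\<infinity>y\<in>multi_indices_eq n K. norm (?g (K, y)))) summable_on UNIV"
      by (simp add: finite_multi_indices_eq sum_nonneg)
  qed
  then have g: "?g summable_on Sigma UNIV (multi_indices_eq n)"
    by (rule Infinite_Sum.abs_summable_summable)
  have "(?g has_sum suminf S) (Sigma UNIV (multi_indices_eq n))"
  proof (rule has_sum_SigmaI[OF _ sums g])
    fix K
    show "((\<lambda>y. ?g (K, y)) has_sum S K) (multi_indices_eq n K)"
      using has_sum_finite[OF finite_multi_indices_eq[of n K], of f] by (simp add: S)
  qed
  moreover have "((\<lambda>z. f (snd z)) has_sum suminf S) (Sigma UNIV (multi_indices_eq n))
       \<longleftrightarrow> (f has_sum suminf S) (multi_indices n)"
    by (rule has_sum_reindex_bij_witness[of _ "\<lambda>k. (msize n k, k)" snd])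
      (auto simp: multi_indices_eq_def)
  ultimately show ?thesis by simp
qed

section \<open>The terminating one-dimensional sum\<close>

text \<open>This is the evaluation of \<open>(p^(-K);p)_m\<close> as a quotient of symbols. The
  power \<open>p ^ (K choose 2)\<close>, which the outer sum supplies, combines with the negative
  powers into \<open>p ^ ((K - m) choose 2)\<close>.\<close>

lemma qpoch_inverse_power:
  assumes "p \<noteq> 0" "norm p < 1" "m \<le> K"
  shows "p ^ (K choose 2) * (qpoch (1 / p ^ K) p m * p ^ m)
    = (-1) ^ m * qpoch p p K / qpoch p p (K - m) * p ^ ((K - m) choose 2)"
  using assms(3)
proof (induction m)
  case 0
  then show ?case using qpoch_nonzero[OF assms(2) assms(2)] by simp
next
  case (Suc m)
  then obtain D where D: "K = Suc m + D" by (metis le_Suc_ex)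
  have D1: "K - m = Suc D" "K - Suc m = D" using D by auto
  have nz: "qpoch p p D \<noteq> 0" "1 - p * p ^ D \<noteq> 0"
    using qpoch_nonzero[OF assms(2) assms(2), of D] qpoch_nonzero[OF assms(2) assms(2), of "Suc D"]
    by (auto simp: qpoch_Suc)
  have f: "(1 - 1 / p ^ K * p ^ m) * p = - (1 - p * p ^ D) / p ^ D"
    using assms(1) by (simp add: D power_add field_simps)
  have "p ^ (K choose 2) * (qpoch (1 / p ^ K) p (Suc m) * p ^ Suc m)
     = (p ^ (K choose 2) * (qpoch (1 / p ^ K) p m * p ^ m)) * ((1 - 1 / p ^ K * p ^ m) * p)"
    by (simp add: qpoch_Suc mult_ac)
  also have "\<dots> = (-1) ^ m * qpoch p p K / (qpoch p p D * (1 - p * p ^ D)) * p ^ (D + (D choose 2))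
     * (- (1 - p * p ^ D) / p ^ D)"
    using Suc.IH Suc.prems unfolding f D1 qpoch_Suc Suc_choose_2 by simp
  also have "\<dots> = (-1) ^ Suc m * qpoch p p K / qpoch p p D * p ^ (D choose 2)"
  proof -
    have "S * P / (Q * U) * (V * W) * (- U / V) = - S * P / Q * W" if "U \<noteq> 0" "V \<noteq> 0" for S P Q U V W :: complex
      using that by simp
    from this[OF nz(2), of "p ^ D"] show ?thesis using assms(1) by (simp add: power_add)
  qed
  finally show ?case unfolding D1 .
qed

text \<open>By Milne's fundamental theorem this is the value of the inner sum, so that it depends on
  \<open>k\<close> only through its size \<open>K\<close>.\<close>
definition inner_1d :: "complex \<Rightarrow> (nat \<Rightarrow> complex) \<Rightarrow> complex \<Rightarrow> nat \<Rightarrow> complex" where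
  "inner_1d p \<beta> a K = (\<Sum>m\<le>K. qpoch (1 / p ^ K) p m * qpoch a p m * p ^ m * \<beta> m)"

text \<open>Reversing the order of summation identifies the one-dimensional term with the inverse
  Bailey transform. The case \<open>K = e = 0\<close> is excluded because there
  \<open>1 - p ^ 0\<close> annihilates the left side while the transform is
  \<open>\<beta> 0\<close>.\<close>

lemma inner_1d_eq_bailey_alpha:
  assumes "p \<noteq> 0" "norm p < 1" "K + e > 0"
  shows "(-1) ^ K * p ^ (K choose 2) / qpoch p p K
       * ((1 - p ^ (2 * K + e)) * qpoch p p (K + e - 1) * inner_1d p \<beta> (p ^ (K + e)) K)
     = bailey_alpha p \<beta> e K"
proof -
  have nz: "qpoch p p K \<noteq> 0" using qpoch_nonzero assms(2) by blast
  have "(-1) ^ K * p ^ (K choose 2) / qpoch p p K * inner_1d p \<beta> (p ^ (K + e)) K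
     = (\<Sum>m\<le>K. (-1) ^ K / qpoch p p K * (p ^ (K choose 2) * (qpoch (1 / p ^ K) p m * p ^ m))
          * (qpoch (p ^ (K + e)) p m * \<beta> m))"
    unfolding inner_1d_def sum_distrib_left by (intro sum.cong) (auto simp: mult_ac)
  also have "\<dots> = (\<Sum>m\<le>K. (-1) ^ (K - m) * p ^ ((K - m) choose 2) / qpoch p p (K - m)
          * (qpoch (p ^ (K + e)) p m * \<beta> m))"
  proof (rule sum.cong[OF refl])
    fix m assume m: "m \<in> {..K}"
    then obtain d where d: "K = m + d" by (auto dest: le_Suc_ex)
    have sign: "(-1) ^ K * (-1) ^ m = ((-1) ^ (K - m) :: complex)"
      by (simp add: d power_add mult_ac flip: power_mult_distrib)
    have "(-1) ^ K / qpoch p p K * (p ^ (K choose 2) * (qpoch (1 / p ^ K) p m * p ^ m))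
        = (-1) ^ K * (-1) ^ m * (p ^ ((K - m) choose 2) / qpoch p p (K - m))"
      using m nz by (subst qpoch_inverse_power[OF assms(1,2)]) auto
    then show "(-1) ^ K / qpoch p p K * (p ^ (K choose 2) * (qpoch (1 / p ^ K) p m * p ^ m))
          * (qpoch (p ^ (K + e)) p m * \<beta> m)
        = (-1) ^ (K - m) * p ^ ((K - m) choose 2) / qpoch p p (K - m) * (qpoch (p ^ (K + e)) p m * \<beta> m)"
      unfolding sign by simp
  qed
  also have "\<dots> = (\<Sum>j\<le>K. (-1) ^ j * p ^ (j choose 2) / qpoch p p j * (qpoch (p ^ (K + e)) p (K - j) * \<beta> (K - j)))"
    by (rule sum.reindex_bij_witness[of _ "\<lambda>j. K - j" "\<lambda>j. K - j"]) auto
  finally have *: "(-1) ^ K * p ^ (K choose 2) / qpoch p p K * inner_1d p \<beta> (p ^ (K + e)) K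
    = (\<Sum>j\<le>K. (-1) ^ j * p ^ (j choose 2) / qpoch p p j * (qpoch (p ^ (K + e)) p (K - j) * \<beta> (K - j)))" .
  show ?thesis
    unfolding bailey_alpha_eq[OF assms(3)] *[symmetric] by (simp only: mult_ac)
qed

context milne_params
begin

section \<open>Size of the outer summand\<close>

lemma exp_ln_norm_mult: "exp (ln (norm p) * real j) = norm p ^ j"
  using p_pos by (simp add: mult.commute exp_of_nat_mult)

lemma milne_term_outer:
  "milne_term p n x (\<lambda>_. 0) (\<lambda>_. 1) k =
     (\<Prod>r\<in>{1..n}. \<Prod>s\<in>{r<..n}. (x r * p ^ k r - x s * p ^ k s) / (x r - x s))
     * (\<Prod>r\<in>{1..n}. \<Prod>s\<in>{1..n}. (-1) ^ k r * (x r / x s) ^ k r * p ^ (k r choose 2)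
            / qpoch (p * (x r / x s)) p (k r))"
  unfolding milne_term_def prod_minus_geometric ..

text \<open>Each numerator is at most a constant times \<open>norm p\<close> to the smaller of the
  two exponents. Powers are written as exponentials so that this exponent can later be added to
  those coming from the \<open>x r\<close>.\<close>

lemma norm_vandermonde_le:
  obtains A where "A \<ge> 0"
    "\<And>k. norm (\<Prod>r\<in>{1..n}. \<Prod>s\<in>{r<..n}. (x r * p ^ k r - x s * p ^ k s) / (x r - x s))
         \<le> A * exp (ln (norm p) * (\<Sum>r\<in>{1..n}. \<Sum>s\<in>{r<..n}. real (min (k r) (k s))))"
proof
  define A where "A = (\<Prod>r\<in>{1..n}. \<Prod>s\<in>{r<..n}. (norm (x r) + norm (x s)) / norm (x r - x s))"
  show "A \<ge> 0" unfolding A_def by (intro prod_nonneg ballI) auto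
  fix k :: "nat \<Rightarrow> nat"
  have le: "norm ((x r * p ^ k r - x s * p ^ k s) / (x r - x s))
      \<le> (norm (x r) + norm (x s)) / norm (x r - x s) * exp (ln (norm p) * real (min (k r) (k s)))" for r s
  proof -
    have "norm (x r * p ^ k r - x s * p ^ k s) \<le> norm (x r) * norm p ^ k r + norm (x s) * norm p ^ k s"
      using norm_triangle_ineq4[of "x r * p ^ k r" "x s * p ^ k s"] by (simp add: norm_mult norm_power)
    also have "\<dots> \<le> norm (x r) * norm p ^ min (k r) (k s) + norm (x s) * norm p ^ min (k r) (k s)"
      using p_pos p_less_1 by (intro add_mono mult_left_mono power_decreasing) auto
    finally have "norm (x r * p ^ k r - x s * p ^ k s) \<le> (norm (x r) + norm (x s)) * norm p ^ min (k r) (k s)"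
      by (simp add: algebra_simps)
    then show ?thesis
      unfolding exp_ln_norm_mult norm_divide by (simp add: divide_right_mono)
  qed
  have "norm (\<Prod>r\<in>{1..n}. \<Prod>s\<in>{r<..n}. (x r * p ^ k r - x s * p ^ k s) / (x r - x s))
     \<le> (\<Prod>r\<in>{1..n}. \<Prod>s\<in>{r<..n}. (norm (x r) + norm (x s)) / norm (x r - x s)
          * exp (ln (norm p) * real (min (k r) (k s))))"
    unfolding prod_norm[symmetric] by (intro prod_mono conjI le prod_nonneg ballI norm_ge_zero)
  also have "\<dots> = A * exp (ln (norm p) * (\<Sum>r\<in>{1..n}. \<Sum>s\<in>{r<..n}. real (min (k r) (k s))))"
    unfolding A_def prod.distrib sum_distrib_left by (simp add: exp_sum)
  finally show "norm (\<Prod>r\<in>{1..n}. \<Prod>s\<in>{r<..n}. (x r * p ^ k r - x s * p ^ k s) / (x r - x s))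
         \<le> A * exp (ln (norm p) * (\<Sum>r\<in>{1..n}. \<Sum>s\<in>{r<..n}. real (min (k r) (k s))))" .
qed

text \<open>The inverse denominators are bounded uniformly in \<open>k\<close>, and the rest has an
  explicit norm. Each \<open>x r\<close> occurs both as numerator and as denominator, so its total
  exponent is the deviation \<open>n * k r - msize n k\<close>.\<close>

lemma norm_row_factor_le:
  obtains B where "B \<ge> 0"
    "\<And>k. norm (\<Prod>r\<in>{1..n}. \<Prod>s\<in>{1..n}. (-1) ^ k r * (x r / x s) ^ k r * p ^ (k r choose 2)
            / qpoch (p * (x r / x s)) p (k r))
         \<le> B * exp ((\<Sum>r\<in>{1..n}. ln (norm (x r)) * (real n * real (k r) - real (msize n k)))
                     + ln (norm p) * (real n * (\<Sum>r\<in>{1..n}. real (k r choose 2))))"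
proof -
  have "\<exists>b. b > 0 \<and> (\<forall>j. norm (inverse (qpoch (p * (x r / x s)) p j)) \<le> b)"
    if "r \<in> {1..n}" "s \<in> {1..n}" for r s
    using inverse_qpoch_bounded[OF p_less_1, of "p * (x r / x s)"] qpoch_nz[OF that] by metis
  then obtain b where b: "\<And>r s. r \<in> {1..n} \<Longrightarrow> s \<in> {1..n} \<Longrightarrow> b r s > 0"
      "\<And>r s j. r \<in> {1..n} \<Longrightarrow> s \<in> {1..n} \<Longrightarrow> norm (inverse (qpoch (p * (x r / x s)) p j)) \<le> b r s"
    by metis
  define B where "B = (\<Prod>r\<in>{1..n}. \<Prod>s\<in>{1..n}. b r s)"
  show thesis
  proof
    show "B \<ge> 0" unfolding B_def using b(1) by (intro prod_nonneg ballI less_imp_le) auto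
    fix k :: "nat \<Rightarrow> nat"
    define E where "E r s = real (k r) * (ln (norm (x r)) - ln (norm (x s))) + ln (norm p) * real (k r choose 2)"
      for r s
    have le: "norm ((-1) ^ k r * (x r / x s) ^ k r * p ^ (k r choose 2) / qpoch (p * (x r / x s)) p (k r))
       \<le> b r s * exp (E r s)" if rs: "r \<in> {1..n}" "s \<in> {1..n}" for r s
    proof -
      have pos: "norm (x r) > 0" "norm (x s) > 0" using x_nz rs by auto
      have "exp (E r s) = (norm (x r) / norm (x s)) ^ k r * norm p ^ (k r choose 2)"
        using pos p_pos unfolding E_def exp_add
        by (simp add: exp_of_nat_mult exp_diff mult.commute[of "ln (norm p)"])
      then have "norm ((-1) ^ k r * (x r / x s) ^ k r * p ^ (k r choose 2) / qpoch (p * (x r / x s)) p (k r))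
        = exp (E r s) * norm (inverse (qpoch (p * (x r / x s)) p (k r)))"
        by (simp add: norm_mult norm_divide norm_power norm_inverse divide_inverse)
      also have "\<dots> \<le> exp (E r s) * b r s" using b(2)[OF rs] by (intro mult_left_mono) auto
      finally show ?thesis by (simp add: mult.commute)
    qed
    have "norm (\<Prod>r\<in>{1..n}. \<Prod>s\<in>{1..n}. (-1) ^ k r * (x r / x s) ^ k r * p ^ (k r choose 2)
            / qpoch (p * (x r / x s)) p (k r)) \<le> (\<Prod>r\<in>{1..n}. \<Prod>s\<in>{1..n}. b r s * exp (E r s))"
      unfolding prod_norm[symmetric] by (intro prod_mono conjI le prod_nonneg ballI norm_ge_zero)
    also have "\<dots> = B * exp (\<Sum>r\<in>{1..n}. \<Sum>s\<in>{1..n}. E r s)"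
      unfolding B_def prod.distrib by (simp add: exp_sum)
    also have "(\<Sum>r\<in>{1..n}. \<Sum>s\<in>{1..n}. E r s)
       = (\<Sum>r\<in>{1..n}. ln (norm (x r)) * (real n * real (k r) - real (msize n k)))
                     + ln (norm p) * (real n * (\<Sum>r\<in>{1..n}. real (k r choose 2)))"
    proof -
      have "(\<Sum>r\<in>{1..n}. \<Sum>s\<in>{1..n}. E r s) = (\<Sum>r\<in>{1..n}. real n * real (k r) * ln (norm (x r)))
         - (\<Sum>r\<in>{1..n}. real (k r)) * (\<Sum>s\<in>{1..n}. ln (norm (x s)))
         + (\<Sum>r\<in>{1..n}. real n * (ln (norm p) * real (k r choose 2)))"
        unfolding E_def sum_product
        by (simp add: sum.distrib sum_subtractf right_diff_distrib mult_ac)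
      also have "(\<Sum>r\<in>{1..n}. real (k r)) = real (msize n k)" by (simp add: msize_def)
      finally show ?thesis
        by (simp add: right_diff_distrib sum_subtractf sum_distrib_left sum_distrib_right mult_ac)
    qed
    finally show "norm (\<Prod>r\<in>{1..n}. \<Prod>s\<in>{1..n}. (-1) ^ k r * (x r / x s) ^ k r * p ^ (k r choose 2)
            / qpoch (p * (x r / x s)) p (k r))
         \<le> B * exp ((\<Sum>r\<in>{1..n}. ln (norm (x r)) * (real n * real (k r) - real (msize n k)))
                     + ln (norm p) * (real n * (\<Sum>r\<in>{1..n}. real (k r choose 2))))" .
  qed
qed

end

lemma real_choose_2: "real (k choose 2) = (real k ^ 2 - real k) / 2"
  by (induction k) (auto simp: Suc_choose_2 power2_eq_square field_simps binomial_eq_0 simp del: binomial_Suc_Suc)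

text \<open>The exponent of the outer summand is at least \<open>binom(K,2)\<close> plus a positive definite
  quadratic form in the deviations \<open>n k\<^sub>r - K\<close>, up to terms that are linear in the deviations.\<close>
lemma exponent_lower_bound:
  fixes k :: "nat \<Rightarrow> nat"
  assumes "n \<ge> 1"
  defines "K \<equiv> msize n k"
  defines "d \<equiv> \<lambda>r. real n * real (k r) - real K"
  shows "real (K choose 2) + (\<Sum>r\<in>{1..n}. (d r)\<^sup>2 / (2 * real n) - \<bar>d r\<bar> / 2)
     \<le> real n * (\<Sum>r\<in>{1..n}. real (k r choose 2))
       + (\<Sum>r\<in>{1..n}. \<Sum>s\<in>{r<..n}. real (min (k r) (k s)))"
proof -
  have n: "real n > 0" "real n \<ge> 1" using assms(1) by auto
  have K: "(\<Sum>r\<in>{1..n}. real (k r)) = real K" by (simp add: K_def msize_def)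
  have sq: "(\<Sum>r\<in>{1..n}. (d r)\<^sup>2) = (real n)\<^sup>2 * (\<Sum>r\<in>{1..n}. (real (k r))\<^sup>2) - real n * (real K)\<^sup>2"
  proof -
    have "(\<Sum>r\<in>{1..n}. (d r)\<^sup>2) = (\<Sum>r\<in>{1..n}. (real n)\<^sup>2 * (real (k r))\<^sup>2
        - (2 * real n * real K) * real (k r) + (real K)\<^sup>2)"
      by (intro sum.cong) (auto simp: d_def power2_eq_square algebra_simps)
    also have "\<dots> = (real n)\<^sup>2 * (\<Sum>r\<in>{1..n}. (real (k r))\<^sup>2) - (2 * real n * real K) * real K
        + real n * (real K)\<^sup>2"
      by (simp add: sum.distrib sum_subtractf K del: One_nat_def flip: sum_distrib_left)
    finally show ?thesis by (simp add: power2_eq_square algebra_simps)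
  qed
  \<comment> \<open>The minimum is half of the sum minus the distance, and the distance is at most
    the sum of the two deviations divided by \<open>n\<close>.\<close>
  have pairs: "real (min (k r) (k s)) \<ge> (real (k r) / 2 - \<bar>d r\<bar> / (2 * real n)) + (real (k s) / 2 - \<bar>d s\<bar> / (2 * real n))" for r s
  proof -
    have "real (min (k r) (k s)) = (real (k r) + real (k s) - \<bar>real (k r) - real (k s)\<bar>) / 2"
      by (simp add: min_def abs_if)
    moreover have "\<bar>real (k r) - real (k s)\<bar> \<le> \<bar>d r\<bar> / real n + \<bar>d s\<bar> / real n"
    proof -
      have "real n * \<bar>real (k r) - real (k s)\<bar> = \<bar>d r - d s\<bar>"
        using n by (simp add: d_def abs_mult flip: right_diff_distrib)
      also have "\<dots> \<le> \<bar>d r\<bar> + \<bar>d s\<bar>" by simp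
      finally show ?thesis using n by (simp add: field_simps)
    qed
    moreover have "\<bar>d t\<bar> / (2 * real n) = \<bar>d t\<bar> / real n / 2" for t by simp
    ultimately show ?thesis by (simp only:) argo
  qed
  have "(\<Sum>r\<in>{1..n}. \<Sum>s\<in>{r<..n}. real (min (k r) (k s)))
      \<ge> (\<Sum>r\<in>{1..n}. \<Sum>s\<in>{r<..n}. (real (k r) / 2 - \<bar>d r\<bar> / (2 * real n)) + (real (k s) / 2 - \<bar>d s\<bar> / (2 * real n)))"
    by (intro sum_mono pairs)
  also have "(\<Sum>r\<in>{1..n}. \<Sum>s\<in>{r<..n}. (real (k r) / 2 - \<bar>d r\<bar> / (2 * real n)) + (real (k s) / 2 - \<bar>d s\<bar> / (2 * real n)))
      = (real n - 1) * (real K / 2 - (\<Sum>r\<in>{1..n}. \<bar>d r\<bar>) / (2 * real n))"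
    unfolding sum_pairs by (simp add: sum_subtractf K del: One_nat_def flip: sum_divide_distrib)
  finally have P: "(real n - 1) * (real K / 2 - (\<Sum>r\<in>{1..n}. \<bar>d r\<bar>) / (2 * real n))
      \<le> (\<Sum>r\<in>{1..n}. \<Sum>s\<in>{r<..n}. real (min (k r) (k s)))" .
  define T where "T = (\<Sum>r\<in>{1..n}. \<bar>d r\<bar>)"
  have T: "T \<ge> 0" unfolding T_def by (intro sum_nonneg) auto
  \<comment> \<open>Alone, this gives only \<open>K^2/2 - n K/2\<close> besides the quadratic form.
    The Vandermonde minima contribute the missing \<open>(n - 1) K/2\<close> that completes
    \<open>K choose 2\<close>.\<close>
  have q: "real n * (\<Sum>r\<in>{1..n}. real (k r choose 2))
      = ((\<Sum>r\<in>{1..n}. (d r)\<^sup>2) / real n + (real K)\<^sup>2) / 2 - real n * real K / 2"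
  proof -
    have "(\<Sum>r\<in>{1..n}. real (k r choose 2)) = ((\<Sum>r\<in>{1..n}. (real (k r))\<^sup>2) - real K) / 2"
      unfolding real_choose_2 by (simp add: sum_subtractf K del: One_nat_def flip: sum_divide_distrib)
    moreover have "(\<Sum>r\<in>{1..n}. (d r)\<^sup>2) / real n = real n * (\<Sum>r\<in>{1..n}. (real (k r))\<^sup>2) - (real K)\<^sup>2"
      unfolding sq using n by (simp add: field_simps power2_eq_square)
    ultimately show ?thesis by (simp only:) (simp add: field_simps)
  qed
  have l: "(\<Sum>r\<in>{1..n}. (d r)\<^sup>2 / (2 * real n) - \<bar>d r\<bar> / 2) = (\<Sum>r\<in>{1..n}. (d r)\<^sup>2) / (2 * real n) - T / 2"
    unfolding T_def by (simp add: sum_subtractf flip: sum_divide_distrib)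
  \<comment> \<open>The loss in the deviations is simplified by
    \<open>(n - 1) / (2 n) \<le> 1/2\<close>.\<close>
  have "(real n - 1) * (real K / 2 - T / (2 * real n)) \<ge> real n * real K / 2 - real K / 2 - T / 2"
    using n T by (simp add: field_simps)
  moreover have "X / (2 * real n) = X / real n / 2" for X by simp
  ultimately show ?thesis
    using P unfolding q l real_choose_2[of K] T_def[symmetric] by (simp only:) argo
qed

context milne_params
begin

text \<open>The positive definite quadratic form in the deviations dominates all linear terms in
  them, including those from the powers of the \<open>x r\<close>. They cost only a constant, and
  the factor \<open>norm p ^ (msize n k choose 2)\<close> remains.\<close>

lemma norm_milne_term_outer_le:
  assumes "n \<ge> 1"
  obtains C where "C \<ge> 0"
    "\<And>k. norm (milne_term p n x (\<lambda>_. 0) (\<lambda>_. 1) k) \<le> C * norm p ^ (msize n k choose 2)"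
proof -
  obtain A where A: "A \<ge> 0"
    "\<And>k. norm (\<Prod>r\<in>{1..n}. \<Prod>s\<in>{r<..n}. (x r * p ^ k r - x s * p ^ k s) / (x r - x s))
         \<le> A * exp (ln (norm p) * (\<Sum>r\<in>{1..n}. \<Sum>s\<in>{r<..n}. real (min (k r) (k s))))"
    using norm_vandermonde_le by blast
  obtain B where B: "B \<ge> 0"
    "\<And>k. norm (\<Prod>r\<in>{1..n}. \<Prod>s\<in>{1..n}. (-1) ^ k r * (x r / x s) ^ k r * p ^ (k r choose 2)
            / qpoch (p * (x r / x s)) p (k r))
         \<le> B * exp ((\<Sum>r\<in>{1..n}. ln (norm (x r)) * (real n * real (k r) - real (msize n k)))
                     + ln (norm p) * (real n * (\<Sum>r\<in>{1..n}. real (k r choose 2))))"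
    using norm_row_factor_le by blast
  define L where "L = - ln (norm p)"
  have L: "L > 0" unfolding L_def using p_pos p_less_1 by simp
  define M where "M = (\<Sum>r\<in>{1..n}. \<bar>ln (norm (x r))\<bar>)"
  \<comment> \<open>\<open>a\<close> is the coefficient of the squared deviation. In
    \<open>b\<close>, \<open>M\<close> bounds every \<open>\<bar>ln (norm (x r))\<bar>\<close> and
    \<open>L / 2\<close> comes from the linear loss in \<open>exponent_lower_bound\<close>. The
    maximum of \<open>b * \<bar>t\<bar> - a * t\<^sup>2\<close> is
    \<open>b\<^sup>2 / (4 * a)\<close>, which explains \<open>C\<close>.\<close>
  define a where "a = L / (2 * real n)"
  have a: "a > 0" unfolding a_def using L assms by simp
  define b where "b = M + L / 2"
  define C where "C = A * B * exp (real n * (b\<^sup>2 / (4 * a)))"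
  show thesis
  proof
    show "C \<ge> 0" unfolding C_def using A(1) B(1) by simp
    fix k :: "nat \<Rightarrow> nat"
    let ?K = "msize n k"
    define d where "d r = real n * real (k r) - real ?K" for r
    define Q where "Q = real n * (\<Sum>r\<in>{1..n}. real (k r choose 2))"
    define P where "P = (\<Sum>r\<in>{1..n}. \<Sum>s\<in>{r<..n}. real (min (k r) (k s)))"
    have QP: "real (?K choose 2) + (\<Sum>r\<in>{1..n}. (d r)\<^sup>2 / (2 * real n) - \<bar>d r\<bar> / 2) \<le> Q + P"
      using exponent_lower_bound[OF assms, of k] unfolding d_def Q_def P_def .
    have X: "(\<Sum>r\<in>{1..n}. ln (norm (x r)) * d r) \<le> (\<Sum>r\<in>{1..n}. M * \<bar>d r\<bar>)"
    proof (rule sum_mono)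
      fix r assume r: "r \<in> {1..n}"
      have "\<bar>ln (norm (x r))\<bar> \<le> M"
        unfolding M_def using r by (intro member_le_sum) auto
      then have "\<bar>ln (norm (x r))\<bar> * \<bar>d r\<bar> \<le> M * \<bar>d r\<bar>" by (rule mult_right_mono) simp
      then show "ln (norm (x r)) * d r \<le> M * \<bar>d r\<bar>"
        using abs_ge_self[of "ln (norm (x r)) * d r"] by (simp add: abs_mult)
    qed
    have sq: "b * \<bar>t\<bar> - a * t\<^sup>2 \<le> b\<^sup>2 / (4 * a)" for t
    proof -
      have "0 \<le> (2 * a * \<bar>t\<bar> - b)\<^sup>2" by simp
      also have "\<dots> = b\<^sup>2 - (b * \<bar>t\<bar> - a * t\<^sup>2) * (4 * a)"
        by (simp add: power2_eq_square algebra_simps flip: abs_mult)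
      finally show ?thesis using a by (simp add: pos_le_divide_eq)
    qed
    have "(\<Sum>r\<in>{1..n}. ln (norm (x r)) * d r) - L * (Q + P)
       \<le> (\<Sum>r\<in>{1..n}. M * \<bar>d r\<bar>)
          - L * (real (?K choose 2) + (\<Sum>r\<in>{1..n}. (d r)\<^sup>2 / (2 * real n) - \<bar>d r\<bar> / 2))"
      using X QP L by (intro diff_mono mult_left_mono) auto
    also have "\<dots> = (\<Sum>r\<in>{1..n}. b * \<bar>d r\<bar> - a * (d r)\<^sup>2) - L * real (?K choose 2)"
      unfolding a_def b_def
      by (simp add: sum.distrib sum_subtractf sum_distrib_left algebra_simps)
    also have "\<dots> \<le> (\<Sum>r\<in>{1..n}. b\<^sup>2 / (4 * a)) - L * real (?K choose 2)"
      by (intro diff_right_mono sum_mono sq)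
    finally have E: "(\<Sum>r\<in>{1..n}. ln (norm (x r)) * d r) - L * (Q + P)
       \<le> real n * (b\<^sup>2 / (4 * a)) - L * real (?K choose 2)" by simp
    have "norm (milne_term p n x (\<lambda>_. 0) (\<lambda>_. 1) k)
      \<le> (A * exp (ln (norm p) * P)) * (B * exp ((\<Sum>r\<in>{1..n}. ln (norm (x r)) * d r) + ln (norm p) * Q))"
      unfolding milne_term_outer norm_mult P_def Q_def d_def
      using A B by (intro mult_mono) auto
    also have "\<dots> = A * B * exp ((\<Sum>r\<in>{1..n}. ln (norm (x r)) * d r) - L * (Q + P))"
    proof -
      have e: "(\<Sum>r\<in>{1..n}. ln (norm (x r)) * d r) - L * (Q + P)
        = ln (norm p) * P + ((\<Sum>r\<in>{1..n}. ln (norm (x r)) * d r) + ln (norm p) * Q)"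
        by (simp add: L_def algebra_simps)
      show ?thesis unfolding e by (simp only: exp_add mult_ac)
    qed
    also have "\<dots> \<le> A * B * exp (real n * (b\<^sup>2 / (4 * a)) - L * real (?K choose 2))"
      using A(1) B(1) E by (intro mult_left_mono) auto
    also have "\<dots> = C * norm p ^ (?K choose 2)"
    proof -
      have "exp (- (L * real (?K choose 2))) = norm p ^ (?K choose 2)"
        using exp_ln_norm_mult[of "?K choose 2"] by (simp add: L_def)
      then show ?thesis by (simp only: C_def exp_add diff_conv_add_uminus mult.assoc)
    qed
    finally show "norm (milne_term p n x (\<lambda>_. 0) (\<lambda>_. 1) k) \<le> C * norm p ^ (?K choose 2)" .
  qed
qed

text \<open>As \<open>n \<ge> 1\<close>, the product of the parameters \<open>c\<close> is 0, so
  each factor in Milne's theorem reduces to \<open>- p ^ i\<close>.\<close>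

lemma sum_milne_term_outer:
  assumes "n \<ge> 1"
  shows "(\<Sum>k\<in>multi_indices_eq n K. milne_term p n x (\<lambda>_. 0) (\<lambda>_. 1) k)
     = (-1) ^ K * p ^ (K choose 2) / qpoch p p K"
  using milne_fundamental[of "\<lambda>_. 0" "\<lambda>_. 1" K] prod_minus_geometric[of 1 p K] assms by (simp add: zero_power)

text \<open>The factor \<open>1 - p ^ 0\<close> makes the term \<open>e = K = 0\<close> vanish.\<close>
lemma has_sum_milne_bailey:
  fixes b w :: complex and e :: nat
  assumes n: "n \<ge> 1" and b: "norm b < 1"
  defines "\<beta> \<equiv> \<lambda>m. 1 / (qpoch b p m)\<^sup>2"
  shows "((\<lambda>k. w * (milne_term p n x (\<lambda>_. 0) (\<lambda>_. 1) k
              * ((1 - p ^ (2 * msize n k + e)) * qpoch p p (msize n k + e - 1)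
                 * inner_1d p \<beta> (p ^ (msize n k + e)) (msize n k))))
          has_sum (w * ((qpoch_inf p p)\<^sup>2 / (qpoch_inf b p)\<^sup>2 - (if e = 0 then 1 else 0)))) (multi_indices n)"
proof -
  define R where "R K = (1 - p ^ (2 * K + e)) * qpoch p p (K + e - 1) * inner_1d p \<beta> (p ^ (K + e)) K" for K
  define o' where "o' K = (-1) ^ K * p ^ (K choose 2) / qpoch p p K" for K
  \<comment> \<open>\<open>c\<close> is the transform without its value 1 at \<open>K = 0\<close>
    when \<open>e = 0\<close>, in accordance with the vanishing first term on the left.\<close>
  define c where "c K = bailey_alpha p \<beta> e K - (if K = 0 then if e = 0 then 1 else 0 else 0)" for K
  have oR: "o' K * R K = c K" for K
  proof (cases "K + e = 0")
    case True
    then show ?thesis by (simp add: R_def c_def bailey_alpha_def bailey_gamma_def binomial_eq_0 \<beta>_def)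
  next
    case False
    then have "o' K * R K = bailey_alpha p \<beta> e K"
      unfolding o'_def R_def using inner_1d_eq_bailey_alpha[OF p_nz p_less_1, of K e \<beta>] by simp
    then show ?thesis using False by (auto simp: c_def)
  qed
  obtain C0 where C0: "\<And>K. norm (bailey_alpha p \<beta> e K) \<le> C0 * (real (Suc K) * norm p ^ K)"
    using norm_bailey_alpha_le[OF p_pos p_less_1 b, of e] unfolding \<beta>_def by blast
  have c_le: "norm (c K) \<le> norm (bailey_alpha p \<beta> e K)" for K
    by (auto simp: c_def bailey_alpha_def bailey_gamma_def binomial_eq_0 \<beta>_def)
  have sm_alpha: "summable (\<lambda>K. norm (bailey_alpha p \<beta> e K))"
    by (rule summable_comparison_test'[OF summable_mult[OF summable_power_times_geometric[OF p_pos p_less_1, of 1], of C0], of 0])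
      (use C0 in simp)
  have "\<beta> \<longlonglongrightarrow> 1 / (qpoch_inf b p)\<^sup>2"
    unfolding \<beta>_def using qpoch_inf_nonzero[OF p_less_1 qpoch_nonzero[OF b p_less_1]]
    by (intro tendsto_intros qpoch_tendsto p_less_1) auto
  from bailey_alpha_sums[OF p_less_1 this sm_alpha]
  have "bailey_alpha p \<beta> e sums ((qpoch_inf p p)\<^sup>2 / (qpoch_inf b p)\<^sup>2)" by simp
  from sums_diff[OF this sums_single[of 0 "\<lambda>_. if e = 0 then 1 else 0"]]
  have "c sums ((qpoch_inf p p)\<^sup>2 / (qpoch_inf b p)\<^sup>2 - (if e = 0 then 1 else 0))"
    unfolding c_def[abs_def] .
  then have S: "suminf (\<lambda>K. w * c K) = w * ((qpoch_inf p p)\<^sup>2 / (qpoch_inf b p)\<^sup>2 - (if e = 0 then 1 else 0))"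
    using sums_mult sums_unique by metis
  obtain C where C: "C \<ge> 0"
    "\<And>k. norm (milne_term p n x (\<lambda>_. 0) (\<lambda>_. 1) k) \<le> C * norm p ^ (msize n k choose 2)"
    using norm_milne_term_outer_le[OF n] by blast
  obtain B where B: "B > 0" "\<And>k. norm (qpoch p p k) \<le> B" using qpoch_bounded[OF p_less_1] by blast
  have "((\<lambda>k. w * (milne_term p n x (\<lambda>_. 0) (\<lambda>_. 1) k * R (msize n k))) has_sum suminf (\<lambda>K. w * c K))
      (multi_indices n)"
  proof (rule has_sum_multi_indices[of _ _ "\<lambda>K. norm w * (C * (norm (c K) * B))"])
    fix k
    let ?K = "msize n k"
    have nz: "qpoch p p ?K \<noteq> 0" using qpoch_nonzero p_less_1 by blast
    \<comment> \<open>The bound for the outer summand and the collapsed factor \<open>o'\<close>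
      share the same power of \<open>norm p\<close> and otherwise differ by bounded quantities.
      Hence the decay of \<open>c\<close> transfers to every single summand, not just to the sums
      over a size class.\<close>
    have "norm (c ?K) * norm (qpoch p p ?K) = norm p ^ (?K choose 2) * norm (R ?K)"
      using nz by (simp add: o'_def norm_mult norm_divide norm_power flip: oR)
    then have "norm p ^ (?K choose 2) * norm (R ?K) \<le> norm (c ?K) * B"
      using mult_left_mono[OF B(2)[of ?K], of "norm (c ?K)"] by simp
    then have "C * (norm p ^ (?K choose 2) * norm (R ?K)) \<le> C * (norm (c ?K) * B)"
      using C(1) by (rule mult_left_mono)
    moreover have "norm (milne_term p n x (\<lambda>_. 0) (\<lambda>_. 1) k) * norm (R ?K)
        \<le> C * norm p ^ (?K choose 2) * norm (R ?K)"
      by (rule mult_right_mono[OF C(2)]) simp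
    ultimately show "norm (w * (milne_term p n x (\<lambda>_. 0) (\<lambda>_. 1) k * R ?K)) \<le> norm w * (C * (norm (c ?K) * B))"
      unfolding norm_mult by (intro mult_left_mono) (auto simp: mult.assoc)
  next
    have "norm (real (Suc K) ^ n * (norm w * (C * (norm (c K) * B))))
        \<le> norm w * C * B * C0 * (real (Suc K) ^ Suc n * norm p ^ K)" for K
    proof -
      have "norm (c K) \<le> C0 * (real (Suc K) * norm p ^ K)" using c_le C0 order.trans by blast
      then have "(norm w * C * B * real (Suc K) ^ n) * norm (c K)
          \<le> (norm w * C * B * real (Suc K) ^ n) * (C0 * (real (Suc K) * norm p ^ K))"
        using C(1) B(1) by (intro mult_left_mono) auto
      then show ?thesis using C(1) B(1) by (simp add: mult_ac abs_mult)
    qed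
    then show "summable (\<lambda>K. real (Suc K) ^ n * (norm w * (C * (norm (c K) * B))))"
      by (intro summable_comparison_test'[OF summable_mult[OF summable_power_times_geometric[OF p_pos p_less_1, of "Suc n"], of "norm w * C * B * C0"], of 0])
  next
    fix K
    have "(\<Sum>k\<in>multi_indices_eq n K. w * (milne_term p n x (\<lambda>_. 0) (\<lambda>_. 1) k * R (msize n k)))
       = (\<Sum>k\<in>multi_indices_eq n K. w * R K * milne_term p n x (\<lambda>_. 0) (\<lambda>_. 1) k)"
      by (intro sum.cong) (auto simp: multi_indices_eq_def)
    also have "\<dots> = w * R K * o' K"
      unfolding sum_distrib_left[symmetric] sum_milne_term_outer[OF n] o'_def ..
    also have "\<dots> = w * c K" unfolding oR[symmetric] by simp
    finally show "(\<Sum>k\<in>multi_indices_eq n K. w * (milne_term p n x (\<lambda>_. 0) (\<lambda>_. 1) k * R (msize n k))) = w * c K" .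
  next
    fix K show "0 \<le> norm w * (C * (norm (c K) * B))" using C(1) B(1) by simp
  qed
  then show ?thesis unfolding S R_def .
qed

section \<open>Comparison with the summands of the statement\<close>

text \<open>Each pair releases the factor \<open>p ^ k s\<close> of its larger index, and
  \<open>s\<close> is the larger index of \<open>s - 1\<close> pairs.\<close>

lemma vandermonde_ratio_eq:
  assumes q: "q\<^sup>2 = p"
  shows "(\<Prod>r\<in>{1..n}. \<Prod>s\<in>{r<..n}. (x r * p ^ k r - x s * p ^ k s) / (x r - x s))
    = p ^ (\<Sum>r=1..n. (r - 1) * k r) * vandermonde_ratio q n x k"
proof -
  have q0: "q \<noteq> 0" using q p_nz by auto
  have "(x r * p ^ k r - x s * p ^ k s) / (x r - x s)
      = p ^ k s * ((1 - q powi (2 * int (k r) - 2 * int (k s)) * (x r / x s)) / (1 - x r / x s))"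
    if rs: "r \<in> {1..n}" "s \<in> {r<..n}" for r s
  proof -
    have s: "s \<in> {1..n}" "r \<noteq> s" using rs by auto
    have ne: "x r \<noteq> x s" using inj_onD[OF x_inj _ rs(1) s(1)] s(2) by blast
    have "q powi (2 * int j) = p ^ j" for j
      by (metis q of_nat_mult of_nat_numeral power_int_of_nat power_mult)
    then have e: "q powi (2 * int (k r) - 2 * int (k s)) = p ^ k r / p ^ k s"
      using q0 by (simp add: power_int_diff)
    show ?thesis unfolding e using ne x_nz[OF s(1)] p_nz
      by (simp add: divide_simps) (simp add: algebra_simps)
  qed
  then have "(\<Prod>r\<in>{1..n}. \<Prod>s\<in>{r<..n}. (x r * p ^ k r - x s * p ^ k s) / (x r - x s))
     = (\<Prod>r\<in>{1..n}. \<Prod>s\<in>{r<..n}. p ^ k s) * vandermonde_ratio q n x k"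
    unfolding vandermonde_ratio_def prod.distrib[symmetric] by (intro prod.cong) auto
  also have "(\<Prod>r\<in>{1..n}. \<Prod>s\<in>{r<..n}. p ^ k s) = p ^ (\<Sum>r=1..n. (r - 1) * k r)"
    unfolding power_sum[symmetric] sum_upper_triangle by simp
  finally show ?thesis .
qed

text \<open>This accounts for the monomial factor: the weight \<open>(r - 1) * k r\<close> comes
  from the Vandermonde product, and the sign, the binomial exponents and the powers of
  \<open>x r\<close> come from the numerators of the limiting case \<open>c = 0\<close>,
  \<open>a = 1\<close>.\<close>

lemma milne_term_outer_eq:
  assumes q: "q\<^sup>2 = p"
  shows "vandermonde_ratio q n x k * monomial_factor w q n x k / denom_prod q n x k
     = w * milne_term p n x (\<lambda>_. 0) (\<lambda>_. 1) k"
proof -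
  let ?K = "msize n k"
  have "(\<Prod>r\<in>{1..n}. \<Prod>s\<in>{1..n}. (-1 :: complex) ^ k r) = (-1) ^ (n * ?K)"
    unfolding power_sum[symmetric] by (simp add: msize_def sum_distrib_left)
  moreover have "(\<Prod>r\<in>{1..n}. \<Prod>s\<in>{1..n}. (x r / x s) ^ k r)
      = (\<Prod>r=1..n. x r powi (int (n * k r) - int ?K))"
  proof -
    have "(\<Prod>r\<in>{1..n}. \<Prod>s\<in>{1..n}. (x r / x s) ^ k r)
       = (\<Prod>r\<in>{1..n}. x r ^ (n * k r)) / (\<Prod>s\<in>{1..n}. \<Prod>r\<in>{1..n}. x s ^ k r)"
      unfolding power_divide prod_dividef
      by (subst (3) prod.swap) (simp add: mult.commute flip: power_mult)
    also have "\<dots> = (\<Prod>r\<in>{1..n}. x r ^ (n * k r) / x r ^ ?K)"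
      unfolding prod_dividef power_sum[symmetric] msize_def ..
    also have "\<dots> = (\<Prod>r=1..n. x r powi (int (n * k r) - int ?K))"
      using x_nz by (intro prod.cong refl) (simp add: power_int_diff del: of_nat_mult)
    finally show ?thesis .
  qed
  moreover have "(\<Prod>r\<in>{1..n}. \<Prod>s\<in>{1..n}. p ^ (k r choose 2)) = p ^ (n * (\<Sum>r=1..n. k r choose 2))"
    unfolding power_sum[symmetric] by (simp add: sum_distrib_left)
  moreover have "q ^ (2 * (\<Sum>r=1..n. (r - 1) * k r) + 2 * n * (\<Sum>r=1..n. k r choose 2))
      = p ^ (\<Sum>r=1..n. (r - 1) * k r) * p ^ (n * (\<Sum>r=1..n. k r choose 2))"
    unfolding power_add power_mult mult.assoc by (simp only: q power_mult)
  ultimately show ?thesis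
    unfolding milne_term_outer monomial_factor_def denom_prod_def vandermonde_ratio_eq[OF q] q
    unfolding prod_dividef prod.distrib
    by (simp only: mult_ac times_divide_eq_right times_divide_eq_left)
qed

text \<open>Milne's theorem applies with \<open>c = 1\<close> and the parameters
  \<open>1 / p ^ k s\<close>, whose product is \<open>1 / p ^ msize n k\<close>, because the
  remaining weight \<open>h\<close> depends only on the size of \<open>m\<close>. The box
  \<open>m \<le> k\<close> may be enlarged to full size classes, since all added terms
  vanish.\<close>

lemma inner_sum_eq_inner_1d:
  assumes q: "q\<^sup>2 = p"
  shows "inner_sum q n x a k = inner_1d p (\<lambda>m. 1 / (qpoch q p m)\<^sup>2) a (msize n k)"
proof -
  let ?K = "msize n k"
  define W where "W = milne_term p n x (\<lambda>_. 1) (\<lambda>s. 1 / p ^ k s)"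
  define h where "h N = qpoch a p N * qpoch p p N / (qpoch q p N * qpoch q p N) * p ^ N" for N
  have nzp: "qpoch p p N \<noteq> 0" for N using qpoch_nonzero p_less_1 by blast
  have powi: "q powi (- 2 * int j) = 1 / p ^ j" for j
  proof -
    have "q powi (- 2 * int j) = inverse (q powi (int (2 * j)))"
      by (simp add: power_int_minus)
    then show ?thesis by (simp only: power_int_of_nat power_mult q inverse_eq_divide)
  qed
  have "inner_sum q n x a k = (\<Sum>m\<in>multi_indices_le n k. W m * h (msize n m))"
    unfolding inner_sum_def
  proof (rule sum.cong[OF refl])
    fix m
    \<comment> \<open>The part with \<open>r - 1\<close> belongs to the Vandermonde product; the
      rest is \<open>p ^ msize n m\<close>, which goes into \<open>h\<close>.\<close>
    have "(\<Sum>r=1..n. r * m r) = (\<Sum>r=1..n. (r - 1) * m r) + msize n m"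
      unfolding msize_def sum.distrib[symmetric]
    proof (rule sum.cong[OF refl])
      fix r assume "r \<in> {1..n}"
      then show "r * m r = (r - 1) * m r + m r" by (cases r) auto
    qed
    then have e: "q ^ (2 * (\<Sum>r=1..n. r * m r)) = p ^ (\<Sum>r=1..n. (r - 1) * m r) * p ^ msize n m"
      by (simp only: power_mult q power_add)
    have W: "W m = p ^ (\<Sum>r=1..n. (r - 1) * m r) * vandermonde_ratio q n x m
      * (\<Prod>r=1..n. \<Prod>s=1..n. qpoch (1 / p ^ k s * (x r / x s)) p (m r) / qpoch (p * (x r / x s)) p (m r))"
      unfolding W_def milne_term_def vandermonde_ratio_eq[OF q] qpoch_def[of "1 / _ * _"] ..
    show "vandermonde_ratio q n x m
        * (\<Prod>r=1..n. \<Prod>s=1..n. qpoch (q powi (- 2 * int (k s)) * (x r / x s)) (q\<^sup>2) (m r)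
             / qpoch (q\<^sup>2 * (x r / x s)) (q\<^sup>2) (m r))
        * (qpoch a (q\<^sup>2) (msize n m) * qpoch (q\<^sup>2) (q\<^sup>2) (msize n m)
           / (qpoch q (q\<^sup>2) (msize n m) * qpoch q (q\<^sup>2) (msize n m)))
        * q ^ (2 * (\<Sum>r=1..n. r * m r)) = W m * h (msize n m)"
      unfolding e W h_def q powi by (simp only: mult_ac)
  qed
  also have "\<dots> = (\<Sum>m\<in>(\<Union>N\<in>{..?K}. multi_indices_eq n N). W m * h (msize n m))"
  proof (rule sum.mono_neutral_left)
    show "finite (\<Union>N\<in>{..?K}. multi_indices_eq n N)" by (simp add: finite_multi_indices_eq)
    show "multi_indices_le n k \<subseteq> (\<Union>N\<in>{..?K}. multi_indices_eq n N)"
    proof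
      fix m assume m: "m \<in> multi_indices_le n k"
      then have "msize n m \<le> ?K"
        unfolding msize_def by (intro sum_mono) (auto simp: multi_indices_le_def PiE_iff)
      moreover have "m \<in> multi_indices n"
        using m by (auto simp: multi_indices_le_def multi_indices_def PiE_iff)
      ultimately show "m \<in> (\<Union>N\<in>{..?K}. multi_indices_eq n N)" by (auto simp: multi_indices_eq_def)
    qed
    show "\<forall>m\<in>(\<Union>N\<in>{..?K}. multi_indices_eq n N) - multi_indices_le n k. W m * h (msize n m) = 0"
    proof
      fix m assume "m \<in> (\<Union>N\<in>{..?K}. multi_indices_eq n N) - multi_indices_le n k"
      then obtain r where r: "r \<in> {1..n}" "k r < m r"
        by (auto simp: multi_indices_eq_def multi_indices_le_def multi_indices_def PiE_iff not_le)
      \<comment> \<open>If \<open>m r\<close> exceeds \<open>k r\<close>, the diagonal factor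
        \<open>s = r\<close> with index \<open>i = k r\<close> occurs and is zero.\<close>
      have "1 - 1 / p ^ k r * (x r / x r) * p ^ k r = 0" using x_nz[OF r(1)] p_nz by simp
      then have "(\<Prod>i<m r. 1 - 1 / p ^ k r * (x r / x r) * p ^ i) = 0"
        by (intro prod_zero bexI[of _ "k r"]) (use r(2) in auto)
      then have "(\<Prod>i<m r. 1 - 1 / p ^ k r * (x r / x r) * p ^ i) / qpoch (p * (x r / x r)) p (m r) = 0"
        by (simp only: div_0)
      then have "W m = 0"
        unfolding W_def milne_term_def
        by (intro mult_eq_0_iff[THEN iffD2] disjI2 prod_zero bexI[OF _ r(1)]) auto
      then show "W m * h (msize n m) = 0" by simp
    qed
  qed
  also have "\<dots> = (\<Sum>N\<le>?K. \<Sum>m\<in>multi_indices_eq n N. W m * h (msize n m))"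
    by (rule sum.UNION_disjoint) (auto simp: finite_multi_indices_eq, auto simp: multi_indices_eq_def)
  also have "\<dots> = (\<Sum>N\<le>?K. h N * (\<Sum>m\<in>multi_indices_eq n N. W m))"
    unfolding sum_distrib_left by (intro sum.cong) (auto simp: multi_indices_eq_def)
  also have "\<dots> = inner_1d p (\<lambda>m. 1 / (qpoch q p m)\<^sup>2) a ?K"
    unfolding inner_1d_def
  proof (rule sum.cong[OF refl])
    fix N
    have "(\<Prod>s\<in>{1..n}. 1 / p ^ k s) = 1 / p ^ ?K"
      unfolding prod_dividef msize_def power_sum by simp
    then have "(\<Sum>m\<in>multi_indices_eq n N. W m) = qpoch (1 / p ^ ?K) p N / qpoch p p N"
      unfolding W_def milne_fundamental qpoch_def by simp
    then show "h N * (\<Sum>m\<in>multi_indices_eq n N. W m)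
        = qpoch (1 / p ^ ?K) p N * qpoch a p N * p ^ N * (1 / (qpoch q p N)\<^sup>2)"
      using nzp[of N] by (simp add: h_def power2_eq_square)
  qed
  finally show ?thesis .
qed

end

theorem theorem5p3:
  fixes q w :: complex and n :: nat and x :: "nat \<Rightarrow> complex"
  assumes "0 < norm q" and "norm q < 1"
    and "w ^ 4 = q"
    and "n \<ge> 1"
    and "\<And>r. r \<in> {1..n} \<Longrightarrow> x r \<noteq> 0"
    and "\<And>r s. 1 \<le> r \<Longrightarrow> r < s \<Longrightarrow> s \<le> n \<Longrightarrow> 1 - x r / x s \<noteq> 0"
    and "\<And>r s k. r \<in> {1..n} \<Longrightarrow> s \<in> {1..n} \<Longrightarrow> qpoch (q\<^sup>2 * (x r / x s)) (q\<^sup>2) k \<noteq> 0"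
  shows "(summand1 w q n x summable_on multi_indices n
          \<and> pi_q w q = (1 - q\<^sup>2) * (\<Sum>\<^sub>\<infinity>k\<in>multi_indices n. summand1 w q n x k))
       \<and> (summand2 w q n x summable_on {k \<in> multi_indices n. msize n k \<ge> 1}
          \<and> pi_q w q = (1 - q\<^sup>2) * w
              + (1 - q\<^sup>2) * (\<Sum>\<^sub>\<infinity>k\<in>{k \<in> multi_indices n. msize n k \<ge> 1}. summand2 w q n x k))"
proof -
  define p where "p = q\<^sup>2"
  have neq: "x r \<noteq> x s" if "r \<in> {1..n}" "s \<in> {1..n}" "r < s" for r s
    using assms(5)[of s] assms(6)[of r s] that by auto
  interpret milne_params p n x
  proof
    show "0 < norm p" "norm p < 1"
      using assms(1,2) by (simp_all add: p_def norm_power power_less_one_iff)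
    show "inj_on x {1..n}"
      by (rule inj_onI) (metis neq linorder_neqE_nat)
  qed (use assms(5,7) in \<open>simp_all add: p_def\<close>)
  have q: "q\<^sup>2 = p" by (simp add: p_def)
  define \<beta> where "\<beta> = (\<lambda>m. 1 / (qpoch q p m)\<^sup>2)"
  \<comment> \<open>The first series is the case \<open>e = 1\<close>, the second the case
    \<open>e = 0\<close>.\<close>
  define T where "T e k = w * (milne_term p n x (\<lambda>_. 0) (\<lambda>_. 1) k
              * ((1 - p ^ (2 * msize n k + e)) * qpoch p p (msize n k + e - 1)
                 * inner_1d p \<beta> (p ^ (msize n k + e)) (msize n k)))" for e k
  define Q where "Q = (qpoch_inf p p)\<^sup>2 / (qpoch_inf q p)\<^sup>2"
  have T: "(T e has_sum (w * (Q - (if e = 0 then 1 else 0)))) (multi_indices n)" for e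
    unfolding T_def Q_def \<beta>_def using has_sum_milne_bailey[OF assms(4,2), of w e] .
  have summand: "vandermonde_ratio q n x k * (G / denom_prod q n x k) * monomial_factor w q n x k * I
      = w * (milne_term p n x (\<lambda>_. 0) (\<lambda>_. 1) k * (G * I))" for k G I
  proof -
    have "vandermonde_ratio q n x k * (G / denom_prod q n x k) * monomial_factor w q n x k * I
       = (vandermonde_ratio q n x k * monomial_factor w q n x k / denom_prod q n x k) * (G * I)"
      by simp
    then show ?thesis unfolding milne_term_outer_eq[OF q] by simp
  qed
  have pw: "q ^ (4 * K + 2) = p ^ (2 * K + 1)" "q ^ (4 * K) = p ^ (2 * K)"
    "q ^ (2 * K + 2) = p ^ (K + 1)" "q ^ (2 * K) = p ^ K" for K
    unfolding p_def power_mult[symmetric] by (simp_all add: algebra_simps)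
  have s1: "summand1 w q n x = T 1"
    unfolding summand1_def T_def summand pw q inner_sum_eq_inner_1d[OF q] \<beta>_def by (simp add: fun_eq_iff)
  have s2: "summand2 w q n x = T 0"
    unfolding summand2_def T_def summand pw q inner_sum_eq_inner_1d[OF q] \<beta>_def by (simp add: fun_eq_iff)
  \<comment> \<open>For \<open>e = 0\<close> the term of size 0 is zero because of
    \<open>1 - p ^ 0\<close>, so restricting to positive size changes nothing. The 1 subtracted from
    \<open>Q\<close> is the separate summand \<open>(1 - q\<^sup>2) * w\<close> of the second
    formula.\<close>
  have T0: "(T 0 has_sum (w * (Q - 1))) {k \<in> multi_indices n. msize n k \<ge> 1}"
  proof -
    have "(T 0 has_sum (w * (Q - 1))) {k \<in> multi_indices n. msize n k \<ge> 1}
        \<longleftrightarrow> (T 0 has_sum (w * (Q - 1))) (multi_indices n)"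
      by (rule has_sum_cong_neutral) (auto simp: T_def not_less_eq_eq)
    then show ?thesis using T[of 0] by simp
  qed
  have pi: "pi_q w q = (1 - q\<^sup>2) * (w * Q)"
    by (simp add: pi_q_def q Q_def)
  show ?thesis
    unfolding s1 s2 pi
    using T[of 1] T0 by (auto simp: has_sum_imp_summable infsumI algebra_simps)
qed

end
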